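(* Let $\mathcal A$ be a simplicial (real, central) hyperplane arrangement in $\mathbb R^d$ with a chosen base region $B$, and let $\Sigma_1$ and $\Sigma_2$ be shards of $\mathcal A$. Then $\Sigma_1\to\Sigma_2$ in the shard digraph if and only if there exists a shard $\Sigma'_1$ of $\mathcal A$ such that: (i) $\Sigma_1$ and $\Sigma'_1$ are compatible; (ii) $H_{\Sigma_2}$ belongs to the rank-two subarrangement containing $H_{\Sigma_1}$ and $H_{\Sigma'_1}$, but is not a basic hyperplane of that subarrangement; and (iii) $\Sigma_1\cap\Sigma'_1\subseteq\Sigma_2$.
   Context: A hyperplane arrangement $\mathcal A$ is a finite set of linear hyperplanes in $\mathbb R^d$. Its regions are the closures of the connected components of $\mathbb R^d\setminus\bigcup\mathcal A$; $\mathcal A$ is simplicial if every region is a simplicial cone. Fix a region $B$ (the base region). A rank-two subarrangement is a subset $\mathcal A'\subseteq\mathcal A$ with $|\mathcal A'|>1$ of the form $\{H\in\mathcal A: H\supseteq U\}$ for a codimension-$2$ subspace $U$; any two distinct hyperplanes lie in a unique one. The basic hyperplanes of $\mathcal A'$ are the two hyperplanes of $\mathcal A'$ bounding the region of $\mathcal A'$ (regions of the arrangement $\mathcal A'$ alone) that contains $B$. A hyperplane $H_1$ cuts $H_2$ if, in the rank-two subarrangement containing both, $H_1$ is basic and $H_2$ is not. The shards in $H\in\mathcal A$ are the closures of the connected components of $H\setminus\bigcup\{H': H'\text{ cuts }H\}$; the shards of $\mathcal A$ are the shards in all of its hyperplanes. For a shard $\Sigma$, $H_\Sigma$ denotes the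 hyperplane containing it. Two shards are compatible if their relative interiors intersect. The shard digraph has the shards as vertices, with an arrow $\Sigma_1\to\Sigma_2$ if and only if $H_{\Sigma_1}$ cuts $H_{\Sigma_2}$ and $\Sigma_1\cap\Sigma_2$ has codimension $2$. *)

theory Defs
  imports "HOL-Analysis.Analysis"
begin

definition linear_hyperplane :: "'a::euclidean_space set \<Rightarrow> bool" where
  "linear_hyperplane H \<longleftrightarrow> (\<exists>a. a \<noteq> 0 \<and> H = {x. a \<bullet> x = 0})"

definition arrangement :: "'a::euclidean_space set set \<Rightarrow> bool" where
  "arrangement A \<longleftrightarrow> finite A \<and> (\<forall>H\<in>A. linear_hyperplane H)"

definition regions :: "'a::euclidean_space set set \<Rightarrow> 'a set set" where
  "regions A = closure ` components (UNIV - \<Union>A)"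

text \<open>The subspace \<open>L\<close> is the lineality space of the cone. It is nonzero for the regions of an
  arrangement that is not essential (the hyperplanes meet in more than the origin);
  \<open>L = {0}\<close> gives the cones spanned by a linearly independent set.\<close>

definition simplicial_cone :: "'a::euclidean_space set \<Rightarrow> bool" where
  "simplicial_cone K \<longleftrightarrow>
     (\<exists>S L. independent S \<and> subspace L \<and> span S \<inter> L = {0} \<and>
            K = {x + y | x y. x \<in> convex_cone hull S \<and> y \<in> L})"

definition simplicial_arrangement :: "'a::euclidean_space set set \<Rightarrow> bool" where
  "simplicial_arrangement A \<longleftrightarrow> arrangement A \<and> (\<forall>R\<in>regions A. simplicial_cone R)"

definition rank_two_subarrangement ::
  "'a::euclidean_space set set \<Rightarrow> 'a set set \<Rightarrow> bool" where
  "rank_two_subarrangement A A' \<longleftrightarrow>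
     card A' > 1 \<and> (\<exists>U. subspace U \<and> dim U + 2 = DIM('a) \<and> A' = {H \<in> A. U \<subseteq> H})"

text \<open>The hyperplanes are required to be distinct: only then do they lie in a unique
  rank-two subarrangement.\<close>

definition rank_two_containing ::
  "'a::euclidean_space set set \<Rightarrow> 'a set \<Rightarrow> 'a set \<Rightarrow> 'a set set \<Rightarrow> bool" where
  "rank_two_containing A H1 H2 A' \<longleftrightarrow>
     H1 \<noteq> H2 \<and> rank_two_subarrangement A A' \<and> H1 \<in> A' \<and> H2 \<in> A'"

definition basic_hyperplanes ::
  "'a::euclidean_space set \<Rightarrow> 'a set set \<Rightarrow> 'a set set" where
  "basic_hyperplanes B A' =
     {H \<in> A'. \<exists>R \<in> regions A'. B \<subseteq> R \<and> (H \<inter> R) facet_of R}"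

definition cuts ::
  "'a::euclidean_space set set \<Rightarrow> 'a set \<Rightarrow> 'a set \<Rightarrow> 'a set \<Rightarrow> bool" where
  "cuts A B H1 H2 \<longleftrightarrow>
     (\<exists>A'. rank_two_containing A H1 H2 A' \<and>
           H1 \<in> basic_hyperplanes B A' \<and> H2 \<notin> basic_hyperplanes B A')"

definition shards_in ::
  "'a::euclidean_space set set \<Rightarrow> 'a set \<Rightarrow> 'a set \<Rightarrow> 'a set set" where
  "shards_in A B H = closure ` components (H - \<Union>{H' \<in> A. cuts A B H' H})"

definition shards :: "'a::euclidean_space set set \<Rightarrow> 'a set \<Rightarrow> 'a set set" where
  "shards A B = (\<Union>H\<in>A. shards_in A B H)"

definition shard_hyperplane ::
  "'a::euclidean_space set set \<Rightarrow> 'a set \<Rightarrow> 'a set" where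
  "shard_hyperplane A S = (THE H. H \<in> A \<and> S \<subseteq> H)"

definition compatible :: "'a::euclidean_space set \<Rightarrow> 'a set \<Rightarrow> bool" where
  "compatible S1 S2 \<longleftrightarrow> rel_interior S1 \<inter> rel_interior S2 \<noteq> {}"

definition shard_digraph ::
  "'a::euclidean_space set set \<Rightarrow> 'a set \<Rightarrow> ('a set \<times> 'a set) set" where
  "shard_digraph A B =
     {(S1, S2). S1 \<in> shards A B \<and> S2 \<in> shards A B \<and>
        cuts A B (shard_hyperplane A S1) (shard_hyperplane A S2) \<and>
        aff_dim (S1 \<inter> S2) = int DIM('a) - 2}"

end

(*
  Normalise the normal of H so that <nu H, b> = 1 for a point b inside B.  The normals of a
  rank-two subarrangement then lie on an affine line, and its basic hyperplanes are the two
  extreme ones; regions and shards are closures of sign cells.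

  Key fact: if w lies in H but in no hyperplane that cuts H, then H is a wall of the region
  containing w + e b for small e > 0.  Among the regions with w in their closure and wall H, take
  one separated from that region by the fewest hyperplanes; if some are left, cross over at the
  codimension-2 face H Int G, with G a separating wall.  This face exists because the region is
  simplicial, and H stays a wall because it is basic in the subarrangement of H and G.  Hence two
  such hyperplanes H, H' through w are walls of one simplicial region, and evaluating normals at a
  generic point of its face in H Int H' shows that every hyperplane through w cutting a member of
  the subarrangement of H, H' belongs to that subarrangement.

  For the forward direction, S1' is the shard, in the other basic hyperplane, of a generic point w
  of S1 Int S2.  If x in S1 Int S1' were not in S2, then the segment from w to x would cross a
  hyperplane that cuts H_S2, against the above.  Conversely, S1 Int S1' has codimension 2 because
  the relative interiors of the two shards are open in different hyperplanes and meet.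
*)
theory Submission
  imports Defs
begin

section \<open>Open and closed sign cells of a subspace: convexity, closures, relative interiors,
  components\<close>

section \<open>Sign cells\<close>

text \<open>The point \<open>w\<close> only names a sign vector on the normals \<open>N\<close>.
  Comparing signs by products needs no orientation of the normals; the cell is empty if some normal
  in \<open>N\<close> vanishes at \<open>w\<close>.\<close>

definition cell :: "'a::euclidean_space set \<Rightarrow> 'a set \<Rightarrow> 'a \<Rightarrow> 'a set" where
  "cell X N w = {x \<in> X. \<forall>n\<in>N. 0 < (n \<bullet> x) * (n \<bullet> w)}"

definition closed_cell :: "'a::euclidean_space set \<Rightarrow> 'a set \<Rightarrow> 'a \<Rightarrow> 'a set" where
  "closed_cell X N w = {x \<in> X. \<forall>n\<in>N. 0 \<le> (n \<bullet> x) * (n \<bullet> w)}"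

lemma convex_cell:
  assumes "convex X"
  shows "convex (cell X N w)"
proof -
  have eq: "cell X N w = X \<inter> (\<Inter>n\<in>N. {x. ((n \<bullet> w) *\<^sub>R n) \<bullet> x > 0})"
    by (auto simp: cell_def mult.commute)
  show ?thesis
    unfolding eq by (intro convex_Int assms convex_INT convex_halfspace_gt)
qed

lemma convex_closed_cell:
  assumes "convex X"
  shows "convex (closed_cell X N w)"
proof -
  have eq: "closed_cell X N w = X \<inter> (\<Inter>n\<in>N. {x. ((n \<bullet> w) *\<^sub>R n) \<bullet> x \<ge> 0})"
    by (auto simp: closed_cell_def mult.commute)
  show ?thesis
    unfolding eq by (intro convex_Int assms convex_INT convex_halfspace_ge)
qed

lemma closed_closed_cell:
  assumes "closed X"
  shows "closed (closed_cell X N w)"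
proof -
  have eq: "closed_cell X N w = X \<inter> (\<Inter>n\<in>N. {x. ((n \<bullet> w) *\<^sub>R n) \<bullet> x \<ge> 0})"
    by (auto simp: closed_cell_def mult.commute)
  show ?thesis
    unfolding eq by (intro closed_Int assms closed_INT ballI closed_halfspace_ge)
qed

lemma openin_cell:
  assumes "finite N"
  shows "openin (top_of_set X) (cell X N w)"
proof -
  have eq: "cell X N w = X \<inter> (\<Inter>n\<in>N. {x. ((n \<bullet> w) *\<^sub>R n) \<bullet> x > 0})"
    by (auto simp: cell_def mult.commute)
  show ?thesis
    unfolding eq
    by (intro openin_open_Int open_INT assms ballI open_halfspace_gt)
qed

lemma cell_self:
  assumes "w \<in> X" "\<And>n. n \<in> N \<Longrightarrow> n \<bullet> w \<noteq> 0"
  shows "w \<in> cell X N w"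
proof -
  have "0 < (n \<bullet> w) * (n \<bullet> w)" if "n \<in> N" for n
    using assms(2)[OF that] by (metis not_real_square_gt_zero)
  then show ?thesis using assms(1) by (simp add: cell_def)
qed

text \<open>A strict inequality plus a weak one is strict. Arbitrary weights are allowed because
  cells of a subspace are cones; this later lets the weights be chosen so that the combination lands
  on a prescribed hyperplane.\<close>

lemma cell_open_segment:
  assumes "subspace X" "w \<in> cell X N v" "x \<in> closed_cell X N v" "0 < s" "0 \<le> t"
  shows "s *\<^sub>R w + t *\<^sub>R x \<in> cell X N v"
proof -
  have "0 < (n \<bullet> (s *\<^sub>R w + t *\<^sub>R x)) * (n \<bullet> v)" if "n \<in> N" for n
  proof -
    have "0 < s * ((n \<bullet> w) * (n \<bullet> v))" "0 \<le> t * ((n \<bullet> x) * (n \<bullet> v))"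
      using assms that by (auto simp: cell_def closed_cell_def)
    then show ?thesis by (simp add: inner_add_right algebra_simps)
  qed
  moreover have "s *\<^sub>R w + t *\<^sub>R x \<in> X"
    using assms by (auto simp: cell_def closed_cell_def intro!: subspace_add subspace_scale)
  ultimately show ?thesis by (simp add: cell_def)
qed

lemma closure_cell:
  assumes X: "subspace X" and w: "w \<in> X" "\<And>n. n \<in> N \<Longrightarrow> n \<bullet> w \<noteq> 0"
  shows "closure (cell X N w) = closed_cell X N w"
proof
  show "closure (cell X N w) \<subseteq> closed_cell X N w"
    by (intro closure_minimal closed_closed_cell closed_subspace X)
       (auto simp: cell_def closed_cell_def intro: less_imp_le)
  show "closed_cell X N w \<subseteq> closure (cell X N w)"
  proof
    fix x assume x: "x \<in> closed_cell X N w"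
    \<comment> \<open>Adding a vanishing positive multiple of \<open>w\<close> makes all the weak
      inequalities at \<open>x\<close> strict.\<close>
    let ?f = "\<lambda>k. (1 / real (Suc k)) *\<^sub>R w + 1 *\<^sub>R x"
    have "?f k \<in> cell X N w" for k
      by (rule cell_open_segment[OF X cell_self[OF w] x]) auto
    moreover have "?f \<longlonglongrightarrow> 0 *\<^sub>R w + 1 *\<^sub>R x"
      by (intro tendsto_intros LIMSEQ_Suc[OF lim_1_over_n])
    ultimately show "x \<in> closure (cell X N w)"
      unfolding closure_sequential by (intro exI[of _ ?f]) auto
  qed
qed

lemma affine_hull_cell:
  assumes "subspace X" "finite N" "w \<in> X" "\<And>n. n \<in> N \<Longrightarrow> n \<bullet> w \<noteq> 0"
  shows "affine hull (cell X N w) = X"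
proof -
  have "affine hull X = X"
    using assms(1) by (simp add: affine_hull_eq subspace_imp_affine)
  then show ?thesis
    using affine_hull_openin[of X "cell X N w"] openin_cell[OF assms(2), of X w]
      cell_self[of w X N, OF assms(3,4)]
    by (metis empty_iff)
qed

lemma affine_hull_closed_cell:
  assumes "subspace X" "finite N" "w \<in> X" "\<And>n. n \<in> N \<Longrightarrow> n \<bullet> w \<noteq> 0"
  shows "affine hull (closed_cell X N w) = X"
proof
  show "affine hull (closed_cell X N w) \<subseteq> X"
    using assms(1) by (intro hull_minimal) (auto simp: closed_cell_def subspace_imp_affine)
  have "cell X N w \<subseteq> closed_cell X N w"
    by (auto simp: cell_def closed_cell_def less_imp_le)
  then show "X \<subseteq> affine hull (closed_cell X N w)"
    using affine_hull_cell[OF assms] hull_mono by metis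
qed

text \<open>A convex set and its closure have the same relative interior, and the open cell is
  already open in its affine hull \<open>X\<close>.\<close>

lemma rel_interior_closed_cell:
  assumes "subspace X" "finite N" "w \<in> X" "\<And>n. n \<in> N \<Longrightarrow> n \<bullet> w \<noteq> 0"
  shows "rel_interior (closed_cell X N w) = cell X N w"
proof -
  have "rel_interior (closed_cell X N w) = rel_interior (cell X N w)"
    using closure_cell[OF assms(1,3,4)] convex_rel_interior_closure[OF convex_cell[OF subspace_imp_convex[OF assms(1)]]]
    by metis
  also have "\<dots> = cell X N w"
    by (intro rel_interior_openin) (simp add: affine_hull_cell assms openin_cell)
  finally show ?thesis .
qed

text \<open>The cell is convex, hence connected. Conversely, by the intermediate value theorem no
  normal in \<open>N\<close> changes sign on a connected set that avoids the hyperplanes.\<close>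

lemma connected_component_cell:
  assumes X: "convex X" and w: "w \<in> X" "\<And>n. n \<in> N \<Longrightarrow> n \<bullet> w \<noteq> 0"
  shows "connected_component_set (X - (\<Union>n\<in>N. {x. n \<bullet> x = 0})) w = cell X N w"
proof
  show "cell X N w \<subseteq> connected_component_set (X - (\<Union>n\<in>N. {x. n \<bullet> x = 0})) w"
    by (intro connected_component_maximal cell_self w convex_connected convex_cell X)
       (auto simp: cell_def)
  show "connected_component_set (X - (\<Union>n\<in>N. {x. n \<bullet> x = 0})) w \<subseteq> cell X N w"
  proof
    fix x assume "x \<in> connected_component_set (X - (\<Union>n\<in>N. {x. n \<bullet> x = 0})) w"
    then obtain T where T: "connected T" "T \<subseteq> X - (\<Union>n\<in>N. {x. n \<bullet> x = 0})" "w \<in> T" "x \<in> T"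
      by (auto simp: connected_component_def)
    have "0 < (n \<bullet> x) * (n \<bullet> w)" if n: "n \<in> N" for n
    proof (rule ccontr)
      assume "\<not> 0 < (n \<bullet> x) * (n \<bullet> w)"
      then have "(n \<bullet> x \<le> 0 \<and> 0 \<le> n \<bullet> w) \<or> (n \<bullet> w \<le> 0 \<and> 0 \<le> n \<bullet> x)"
        by (auto simp: not_less mult_le_0_iff)
      then have "\<exists>z\<in>T. n \<bullet> z = 0"
        using connected_ivt_hyperplane[OF T(1), of x w n 0] connected_ivt_hyperplane[OF T(1), of w x n 0] T(3,4)
        by auto
      then show False using T(2) n by auto
    qed
    then show "x \<in> cell X N w" using T by (auto simp: cell_def)
  qed
qed

lemma closure_components_eq_closed_cells:
  assumes "subspace X"
  shows "closure ` components (X - (\<Union>n\<in>N. {x. n \<bullet> x = 0})) =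
    {closed_cell X N w | w. w \<in> X \<and> (\<forall>n\<in>N. n \<bullet> w \<noteq> 0)}"
proof -
  let ?U = "X - (\<Union>n\<in>N. {x. n \<bullet> x = 0})"
  have "closure ` components ?U = (\<lambda>w. closure (connected_component_set ?U w)) ` ?U"
    by (auto simp: components_def)
  also have "\<dots> = closed_cell X N ` ?U"
    by (intro image_cong refl)
       (use assms in \<open>auto simp: connected_component_cell subspace_imp_convex closure_cell\<close>)
  also have "\<dots> = {closed_cell X N w | w. w \<in> X \<and> (\<forall>n\<in>N. n \<bullet> w \<noteq> 0)}"
    by auto
  finally show ?thesis .
qed

text \<open>Each strict inequality holds for all small \<open>e\<close> by continuity, and finitely
  many can be met by one \<open>e\<close>. Normals that vanish at \<open>v\<close> are left
  unconstrained; their sign is decided by \<open>z\<close>.\<close>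

lemma exists_small_perturbation:
  fixes v z :: "'a::real_inner"
  assumes "finite N"
  shows "\<exists>e>0. \<forall>n\<in>N. n \<bullet> v \<noteq> 0 \<longrightarrow> 0 < (n \<bullet> (v + e *\<^sub>R z)) * (n \<bullet> v)"
proof -
  have "\<forall>\<^sub>F e in at_right (0::real). \<forall>n\<in>N. n \<bullet> v \<noteq> 0 \<longrightarrow> 0 < (n \<bullet> (v + e *\<^sub>R z)) * (n \<bullet> v)"
  proof (intro eventually_ball_finite assms ballI)
    fix n
    show "\<forall>\<^sub>F e in at_right (0::real). n \<bullet> v \<noteq> 0 \<longrightarrow> 0 < (n \<bullet> (v + e *\<^sub>R z)) * (n \<bullet> v)"
    proof (cases "n \<bullet> v = 0")
      case False
      have "((\<lambda>e. (n \<bullet> (v + e *\<^sub>R z)) * (n \<bullet> v)) \<longlongrightarrow> (n \<bullet> (v + 0 *\<^sub>R z)) * (n \<bullet> v)) (at_right (0::real))"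
        by (intro tendsto_intros)
      moreover have "0 < (n \<bullet> (v + 0 *\<^sub>R z)) * (n \<bullet> v)"
        using False by (simp add: zero_less_mult_iff) linarith
      ultimately show ?thesis
        by (auto dest: order_tendstoD(1) elim: eventually_mono)
    qed auto
  qed
  moreover have "\<forall>\<^sub>F e in at_right (0::real). e > 0"
    by (simp add: eventually_at_right_less)
  ultimately have "\<forall>\<^sub>F e in at_right (0::real). e > 0 \<and>
      (\<forall>n\<in>N. n \<bullet> v \<noteq> 0 \<longrightarrow> 0 < (n \<bullet> (v + e *\<^sub>R z)) * (n \<bullet> v))"
    by eventually_elim auto
  then show ?thesis
    using eventually_happens'[OF trivial_limit_at_right_real] by blast
qed

text \<open>Induction on the normals: a point good for \<open>N\<close> that lies on the new
  hyperplane is moved slightly towards a point \<open>z\<close> of \<open>C\<close> off it.\<close>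

lemma convex_avoids_hyperplanes:
  fixes C :: "'a::real_inner set"
  assumes "finite N" "convex C" "C \<noteq> {}" "\<And>n. n \<in> N \<Longrightarrow> \<exists>x\<in>C. n \<bullet> x \<noteq> 0"
  shows "\<exists>x\<in>C. \<forall>n\<in>N. n \<bullet> x \<noteq> 0"
  using assms(1,4)
proof (induction N rule: finite_induct)
  case empty
  then show ?case using assms(3) by auto
next
  case (insert m N)
  then obtain x where x: "x \<in> C" "\<forall>n\<in>N. n \<bullet> x \<noteq> 0" by auto
  obtain z where z: "z \<in> C" "m \<bullet> z \<noteq> 0" using insert.prems by auto
  show ?case
  proof (cases "m \<bullet> x = 0")
    case False
    then show ?thesis using x by auto
  next
    case True
    obtain e where e: "e > 0" "\<forall>n\<in>N. n \<bullet> x \<noteq> 0 \<longrightarrow> 0 < (n \<bullet> (x + e *\<^sub>R z)) * (n \<bullet> x)"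
      using exists_small_perturbation[OF insert.hyps(1)] by metis
    \<comment> \<open>This is \<open>x + e *\<^sub>R z\<close> rescaled to a convex combination,
      which does not change any sign.\<close>
    define y where "y = (1 / (1 + e)) *\<^sub>R x + (e / (1 + e)) *\<^sub>R z"
    have "y \<in> C"
      unfolding y_def using e(1) x z
      by (intro convexD[OF assms(2)]) (auto simp: add_divide_distrib[symmetric])
    moreover have y: "y = (1 / (1 + e)) *\<^sub>R (x + e *\<^sub>R z)"
      by (simp add: y_def scaleR_add_right)
    have "n \<bullet> y \<noteq> 0" if "n \<in> insert m N" for n
    proof (cases "n \<in> N")
      case True
      then show ?thesis using e x unfolding y by force
    next
      case False
      then show ?thesis using that \<open>m \<bullet> x = 0\<close> z e unfolding y by (auto simp: inner_add_right)
    qed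
    ultimately show ?thesis by blast
  qed
qed

section \<open>Simplicial cones described by dual coordinates\<close>

section \<open>Simplicial cones\<close>

text \<open>The functionals \<open>f s\<close> are the dual basis of the generators, extended by
  zero on the lineality space \<open>L\<close>. Nonempty interior makes \<open>S\<close> and
  \<open>L\<close> together span the space, so these coordinates determine a point modulo
  \<open>L\<close>.\<close>

lemma simplicial_cone_dual:
  fixes R :: "'a::euclidean_space set"
  assumes "simplicial_cone R" "interior R \<noteq> {}"
  obtains S f where "finite S" "R = {x. \<forall>s\<in>S. 0 \<le> f s \<bullet> x}"
    "\<And>s t. s \<in> S \<Longrightarrow> t \<in> S \<Longrightarrow> f s \<bullet> t = (if s = t then 1 else 0)"
proof -
  obtain S L where SL: "independent S" "subspace L" "span S \<inter> L = {0}"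
    and R: "R = {x + y | x y. x \<in> convex_cone hull S \<and> y \<in> L}"
    using assms(1) unfolding simplicial_cone_def by blast
  have finS: "finite S" using SL(1) independent_imp_finite by blast
  have "span S \<noteq> {}" using span_zero by blast
  then have hull_span: "convex_cone hull S \<subseteq> span S"
    by (intro hull_minimal span_superset)
       (auto simp: convex_cone_def subspace_imp_convex subspace_imp_conic)
  have "R \<subseteq> span (S \<union> L)"
    unfolding R using hull_span span_mono[of S "S \<union> L"] by (auto intro!: span_add intro: span_base)
  moreover have "affine hull R = UNIV" using affine_hull_nonempty_interior[OF assms(2)] .
  ultimately have full: "span (S \<union> L) = UNIV"
    by (metis hull_minimal subspace_imp_affine subspace_span top.extremum_uniqueI)
  then have decomp: "\<exists>p l. p \<in> span S \<and> l \<in> L \<and> x = p + l" for x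
  proof -
    have "x \<in> {x + y | x y. x \<in> span S \<and> y \<in> span L}"
      using full span_Un[of S L] by simp
    moreover have "span L = L" using SL(2) by (simp add: span_eq_iff)
    ultimately show ?thesis by auto
  qed
  have "\<exists>a. a \<bullet> s = 1 \<and> (\<forall>y\<in>(S - {s}) \<union> L. a \<bullet> y = 0)" if s: "s \<in> S" for s
  proof -
    let ?W = "(S - {s}) \<union> L"
    have "s \<notin> span ?W"
    proof
      assume "s \<in> span ?W"
      then obtain p l where pl: "p \<in> span (S - {s})" "l \<in> L" "s = p + l"
        using SL(2) span_Un[of "S - {s}" L] by (auto simp: span_eq_iff[THEN iffD2])
      have "p \<in> span S" using pl(1) span_mono[of "S - {s}" S] by auto
      then have "l \<in> span S" using pl(3) s by (metis add_diff_cancel_left' span_base span_diff)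
      then have "l = 0" using SL(3) pl(2) by auto
      then show False using pl SL(1) s by (auto simp: dependent_def)
    qed
    \<comment> \<open>The functional for \<open>s\<close> is a normal of the span of
      \<open>L\<close> and the other generators, scaled to take the value 1 at
      \<open>s\<close>.\<close>
    then have "span ?W \<subset> span UNIV" by auto
    then obtain a where a: "a \<noteq> 0" "\<And>y. y \<in> span ?W \<Longrightarrow> orthogonal a y"
      using orthogonal_to_subspace_exists_gen by metis
    have "a \<bullet> s \<noteq> 0"
    proof
      assume "a \<bullet> s = 0"
      then have "orthogonal a y" if "y \<in> S \<union> L" for y
        using that a(2)[OF span_base, of y] by (cases "y = s") (auto simp: orthogonal_def)
      then have "orthogonal a a"
        using full orthogonal_to_span[of a "S \<union> L" a] by auto
      then show False using a(1) by (simp add: orthogonal_def)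
    qed
    then show ?thesis
      using a(2)[OF span_base] by (intro exI[of _ "(1 / (a \<bullet> s)) *\<^sub>R a"]) (auto simp: orthogonal_def)
  qed
  then obtain f where f: "\<And>s. s \<in> S \<Longrightarrow> f s \<bullet> s = 1"
    "\<And>s y. s \<in> S \<Longrightarrow> y \<in> (S - {s}) \<union> L \<Longrightarrow> f s \<bullet> y = 0"
    by metis
  have delta: "f s \<bullet> t = (if s = t then 1 else 0)" if "s \<in> S" "t \<in> S" for s t
    using f that by auto
  have "R = {x. \<forall>s\<in>S. 0 \<le> f s \<bullet> x}"
  proof (intro set_eqI iffI)
    fix x assume "x \<in> R"
    then obtain p l where pl: "p \<in> convex_cone hull S" "l \<in> L" "x = p + l" unfolding R by auto
    have "convex_cone hull S \<subseteq> (\<Inter>s\<in>S. {x. f s \<bullet> x \<ge> 0})"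
    proof (rule hull_minimal)
      show "S \<subseteq> (\<Inter>s\<in>S. {x. f s \<bullet> x \<ge> 0})" using delta by auto
      show "convex_cone (\<Inter>s\<in>S. {x. f s \<bullet> x \<ge> 0})"
        by (auto simp: convex_cone_iff inner_add_right)
    qed
    then show "x \<in> {x. \<forall>s\<in>S. 0 \<le> f s \<bullet> x}" using pl f by (auto simp: inner_add_right)
  next
    fix x assume x: "x \<in> {x. \<forall>s\<in>S. 0 \<le> f s \<bullet> x}"
    obtain p l where pl: "p \<in> span S" "l \<in> L" "x = p + l" using decomp by blast
    obtain u where u: "p = (\<Sum>v\<in>S. u v *\<^sub>R v)"
      using pl(1) span_finite[OF finS] by auto
    have "0 \<le> u s" if s: "s \<in> S" for s
    proof -
      have "f s \<bullet> x = (\<Sum>v\<in>S. u v * (f s \<bullet> v))"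
        using f s pl by (simp add: u inner_add_right inner_sum_right)
      also have "\<dots> = (\<Sum>v\<in>S. if s = v then u v else 0)"
        by (intro sum.cong refl) (use delta s in auto)
      also have "\<dots> = u s" using finS s by simp
      finally show ?thesis using x s by auto
    qed
    then have "p \<in> convex_cone hull S"
    proof -
      assume u0: "\<And>s. s \<in> S \<Longrightarrow> 0 \<le> u s"
      have "(\<Sum>v\<in>T. u v *\<^sub>R v) \<in> convex_cone hull S" if "finite T" "T \<subseteq> S" for T
        using that
        by (induction T rule: finite_induct)
           (auto intro!: convex_cone_hull_contains_0 convex_cone_hull_add convex_cone_hull_mul u0 intro: hull_inc)
      then show ?thesis using u finS by auto
    qed
    then show "x \<in> R" using pl unfolding R by auto
  qed
  then show thesis using that finS delta by blast
qed

text \<open>The part \<open>z\<close> of \<open>x\<close> with all coordinates zero lies in the cone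
  together with \<open>- z\<close>, so a functional that is nonnegative on the cone vanishes at
  \<open>z\<close>.\<close>

lemma nonneg_on_dual_cone_expansion:
  fixes a :: "'a::euclidean_space"
  assumes "finite S" "\<And>s t. s \<in> S \<Longrightarrow> t \<in> S \<Longrightarrow> f s \<bullet> t = (if s = t then 1 else 0)"
    and nonneg: "\<And>x. (\<And>s. s \<in> S \<Longrightarrow> 0 \<le> f s \<bullet> x) \<Longrightarrow> 0 \<le> a \<bullet> x"
  shows "a \<bullet> x = (\<Sum>s\<in>S. (f s \<bullet> x) * (a \<bullet> s))"
proof -
  define z where "z = x - (\<Sum>s\<in>S. (f s \<bullet> x) *\<^sub>R s)"
  have "f s \<bullet> z = 0" if s: "s \<in> S" for s
  proof -
    have "f s \<bullet> (\<Sum>t\<in>S. (f t \<bullet> x) *\<^sub>R t) = (\<Sum>t\<in>S. if s = t then f t \<bullet> x else 0)"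
      unfolding inner_sum_right by (intro sum.cong refl) (use assms(2) s in auto)
    then show ?thesis using assms(1) s by (simp add: z_def inner_diff_right)
  qed
  then have "0 \<le> a \<bullet> z" "0 \<le> a \<bullet> (- z)" using nonneg[of z] nonneg[of "- z"] by simp_all
  then have "a \<bullet> z = 0" by simp
  then show ?thesis by (simp add: z_def inner_diff_right inner_sum_right)
qed

section \<open>Normals of a rank-two subarrangement on an affine line, and its two extreme
  members\<close>

section \<open>Rank-two subarrangements\<close>

locale based_arrangement =
  fixes A :: "'a::euclidean_space set set" and b :: 'a and \<nu> :: "'a set \<Rightarrow> 'a"
  assumes finite_A: "finite A"
    and mem_iff: "H \<in> A \<Longrightarrow> x \<in> H \<longleftrightarrow> \<nu> H \<bullet> x = 0"
    and normal_base: "H \<in> A \<Longrightarrow> \<nu> H \<bullet> b = 1"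
begin

lemma normal_inj:
  assumes "H \<in> A" "K \<in> A" "\<nu> H = \<nu> K"
  shows "H = K"
  using assms mem_iff by auto

text \<open>Projecting any point along \<open>b\<close> into \<open>H\<close>, and hence into
  \<open>K\<close>, shows that both normals take the same value at it.\<close>

lemma hyperplane_subset_eq:
  assumes "H \<in> A" "K \<in> A" "H \<subseteq> K"
  shows "H = K"
proof (rule normal_inj[OF assms(1,2)])
  have "\<nu> K \<bullet> x = \<nu> H \<bullet> x" for x
  proof -
    have "x - (\<nu> H \<bullet> x) *\<^sub>R b \<in> H"
      using assms(1) by (simp add: mem_iff inner_diff_right normal_base)
    then have "x - (\<nu> H \<bullet> x) *\<^sub>R b \<in> K" using assms(3) by auto
    then show ?thesis
      using assms(2) by (simp add: mem_iff inner_diff_right normal_base)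
  qed
  then show "\<nu> H = \<nu> K" by (metis inner_commute vector_eq_rdot)
qed

lemma subspace_hyperplane_mem: "H \<in> A \<Longrightarrow> subspace H"
  by (auto simp: subspace_def mem_iff inner_add_right)

text \<open>For distinct \<open>H\<close> and \<open>K\<close> in \<open>A\<close> this is the
  rank-two subarrangement containing both, with \<open>H \<inter> K\<close> as its codimension-2
  subspace.\<close>

definition pencil :: "'a set \<Rightarrow> 'a set \<Rightarrow> 'a set set" where
  "pencil H K = {G \<in> A. H \<inter> K \<subseteq> G}"

lemma pencil_commute: "pencil H K = pencil K H"
  by (auto simp: pencil_def)

lemma mem_pencil_left: "H \<in> A \<Longrightarrow> H \<in> pencil H K"
  and mem_pencil_right: "K \<in> A \<Longrightarrow> K \<in> pencil H K"
  by (auto simp: pencil_def)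

lemma pencil_mem [dest]: "G \<in> pencil H K \<Longrightarrow> G \<in> A"
  by (simp add: pencil_def)

text \<open>The component \<open>q\<close> of \<open>\<nu> G\<close> orthogonal to both normals lies
  in \<open>H \<inter> K\<close>, hence in \<open>G\<close>, so it is zero. Evaluating at
  \<open>b\<close> forces the two coefficients to add up to 1.\<close>

lemma pencil_coefficient:
  assumes "H \<in> A" "K \<in> A" "G \<in> pencil H K"
  obtains t where "\<nu> G = (1 - t) *\<^sub>R \<nu> H + t *\<^sub>R \<nu> K"
proof -
  have G: "G \<in> A" "H \<inter> K \<subseteq> G" using assms(3) by (auto simp: pencil_def)
  obtain p q where p: "p \<in> span {\<nu> H, \<nu> K}" and q: "\<And>w. w \<in> span {\<nu> H, \<nu> K} \<Longrightarrow> orthogonal q w"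
    and pq: "\<nu> G = p + q"
    using orthogonal_subspace_decomp_exists[of "{\<nu> H, \<nu> K}" "\<nu> G"] by metis
  have "q \<bullet> \<nu> H = 0" "q \<bullet> \<nu> K = 0" "q \<bullet> p = 0"
    using q p by (auto simp: orthogonal_def span_base)
  then have "q \<in> H \<inter> K" using assms by (auto simp: mem_iff inner_commute)
  then have "\<nu> G \<bullet> q = 0" using G mem_iff by auto
  then have "q \<bullet> q = 0" using pq \<open>q \<bullet> p = 0\<close> by (simp add: inner_add_left inner_add_right inner_commute)
  then have "q = 0" by simp
  obtain c d where cd: "\<nu> G = c *\<^sub>R \<nu> H + d *\<^sub>R \<nu> K"
    using p pq \<open>q = 0\<close> by (auto simp: span_insert span_singleton algebra_simps)
  then have "c = 1 - d"
    using normal_base[OF G(1)] assms by (simp add: inner_add_left normal_base)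
  then show thesis using cd that by auto
qed

text \<open>Distinct members have distinct parameters \<open>s\<close> and \<open>t\<close> on the
  line of normals, so the linear system that expresses their normals by those of \<open>H\<close>
  and \<open>K\<close> is invertible and \<open>E \<inter> F\<close> equals
  \<open>H \<inter> K\<close>.\<close>

lemma pencil_eqI:
  assumes "H \<in> A" "K \<in> A" "E \<in> pencil H K" "F \<in> pencil H K" "E \<noteq> F"
  shows "pencil E F = pencil H K"
proof -
  have EF: "E \<in> A" "F \<in> A" using assms by auto
  obtain s where s: "\<nu> E = (1 - s) *\<^sub>R \<nu> H + s *\<^sub>R \<nu> K" using pencil_coefficient assms by metis
  obtain t where t: "\<nu> F = (1 - t) *\<^sub>R \<nu> H + t *\<^sub>R \<nu> K" using pencil_coefficient assms by metis
  have st: "s \<noteq> t" using assms(5) normal_inj[OF EF] s t by auto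
  have "E \<inter> F \<subseteq> H \<inter> K"
  proof
    fix x assume "x \<in> E \<inter> F"
    then have "\<nu> E \<bullet> x = 0" "\<nu> F \<bullet> x = 0" using EF mem_iff by auto
    then have e: "(1 - s) * (\<nu> H \<bullet> x) + s * (\<nu> K \<bullet> x) = 0" "(1 - t) * (\<nu> H \<bullet> x) + t * (\<nu> K \<bullet> x) = 0"
      by (simp_all add: s t inner_add_left)
    \<comment> \<open>Cramer's rule, with determinant \<open>t - s\<close>.\<close>
    have "(t - s) * (\<nu> H \<bullet> x) = t * ((1 - s) * (\<nu> H \<bullet> x) + s * (\<nu> K \<bullet> x)) - s * ((1 - t) * (\<nu> H \<bullet> x) + t * (\<nu> K \<bullet> x))"
      "(t - s) * (\<nu> K \<bullet> x) = (1 - s) * ((1 - t) * (\<nu> H \<bullet> x) + t * (\<nu> K \<bullet> x)) - (1 - t) * ((1 - s) * (\<nu> H \<bullet> x) + s * (\<nu> K \<bullet> x))"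
      by (simp_all add: algebra_simps)
    then have "(t - s) * (\<nu> H \<bullet> x) = 0" "(t - s) * (\<nu> K \<bullet> x) = 0"
      unfolding e by simp_all
    then show "x \<in> H \<inter> K" using st assms(1,2) by (simp add: mem_iff)
  qed
  moreover have "H \<inter> K \<subseteq> E \<inter> F" using assms(3,4) by (auto simp: pencil_def)
  ultimately show ?thesis by (auto simp: pencil_def)
qed

definition extremes :: "'a set set \<Rightarrow> 'a set \<Rightarrow> 'a set \<Rightarrow> bool" where
  "extremes P E F \<longleftrightarrow> E \<in> A \<and> F \<in> A \<and> E \<noteq> F \<and> P = pencil E F \<and>
     (\<forall>G\<in>P. \<exists>s. 0 \<le> s \<and> s \<le> 1 \<and> \<nu> G = (1 - s) *\<^sub>R \<nu> E + s *\<^sub>R \<nu> F)"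

lemma extremes_sym:
  assumes "extremes P E F"
  shows "extremes P F E"
proof -
  have "\<exists>s. 0 \<le> s \<and> s \<le> 1 \<and> \<nu> G = (1 - s) *\<^sub>R \<nu> F + s *\<^sub>R \<nu> E" if G: "G \<in> P" for G
  proof -
    obtain s where "0 \<le> s" "s \<le> 1" "\<nu> G = (1 - s) *\<^sub>R \<nu> E + s *\<^sub>R \<nu> F"
      using assms G unfolding extremes_def by blast
    then show ?thesis by (intro exI[of _ "1 - s"]) auto
  qed
  then show ?thesis using assms pencil_commute by (auto simp: extremes_def)
qed

text \<open>The members are finitely many points on an affine line; those with least and greatest
  parameter bound a segment containing all of them.\<close>

lemma pencil_extremes:
  assumes "H \<in> A" "K \<in> A" "H \<noteq> K"
  obtains E F where "extremes (pencil H K) E F"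
proof -
  let ?P = "pencil H K"
  have "\<forall>G\<in>?P. \<exists>t. \<nu> G = (1 - t) *\<^sub>R \<nu> H + t *\<^sub>R \<nu> K"
    using pencil_coefficient[OF assms(1,2)] by metis
  then obtain t where t: "\<And>G. G \<in> ?P \<Longrightarrow> \<nu> G = (1 - t G) *\<^sub>R \<nu> H + t G *\<^sub>R \<nu> K"
    by metis
  have HK: "H \<in> ?P" "K \<in> ?P" using assms mem_pencil_left mem_pencil_right by auto
  have fin: "finite (t ` ?P)" using finite_subset[OF _ finite_A, of ?P] by (auto simp: pencil_def)
  have tHK: "t H \<noteq> t K" using t[OF HK(1)] t[OF HK(2)] normal_inj assms by metis
  obtain E where E: "E \<in> ?P" "t E = Min (t ` ?P)"
    using Min_in[OF fin] HK by (metis empty_iff image_iff)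
  obtain F where F: "F \<in> ?P" "t F = Max (t ` ?P)"
    using Max_in[OF fin] HK by (metis empty_iff image_iff)
  have le: "t E \<le> t G" "t G \<le> t F" if "G \<in> ?P" for G
    using that E F fin by auto
  have lt: "t E < t F" using le[OF HK(1)] le[OF HK(2)] tHK by linarith
  have "\<exists>s. 0 \<le> s \<and> s \<le> 1 \<and> \<nu> G = (1 - s) *\<^sub>R \<nu> E + s *\<^sub>R \<nu> F" if G: "G \<in> ?P" for G
  proof -
    \<comment> \<open>The parameter is rescaled so that \<open>E\<close> gets 0 and \<open>F\<close>
      gets 1.\<close>
    define s where "s = (t G - t E) / (t F - t E)"
    have s: "t G = t E + s * (t F - t E)" using lt by (simp add: s_def)
    have "\<nu> G = (1 - s) *\<^sub>R \<nu> E + s *\<^sub>R \<nu> F"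
      unfolding t[OF G] t[OF E(1)] t[OF F(1)] s by (simp add: algebra_simps)
    moreover have "0 \<le> s" "s \<le> 1" using le[OF G] lt by (auto simp: s_def)
    ultimately show ?thesis by blast
  qed
  moreover have "E \<noteq> F" using lt by auto
  ultimately have "extremes ?P E F"
    using E(1) F(1) pencil_eqI[OF assms(1,2) E(1) F(1)] by (auto simp: extremes_def)
  then show thesis using that by blast
qed

text \<open>The witness \<open>v\<close> lies in \<open>H\<close> strictly on the base side of every
  other member. It replaces the facet condition on the region of \<open>P\<close> containing the
  base region; \<open>basic_hyperplanes_eq\<close> proves the two equivalent.\<close>

definition basic :: "'a set set \<Rightarrow> 'a set \<Rightarrow> bool" where
  "basic P H \<longleftrightarrow> H \<in> P \<and> (\<exists>v\<in>H. \<forall>K\<in>P - {H}. 0 < \<nu> K \<bullet> v)"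

lemma extremes_basic:
  assumes "extremes P E F"
  shows "basic P E"
proof -
  have EF: "E \<in> A" "F \<in> A" "E \<noteq> F" "P = pencil E F" using assms by (auto simp: extremes_def)
  then obtain z where z: "z \<in> E" "\<nu> F \<bullet> z \<noteq> 0"
    using hyperplane_subset_eq[OF EF(1,2)] mem_iff by blast
  \<comment> \<open>Scaling \<open>z\<close> by its own value makes \<open>\<nu> F\<close> equal to
    a nonzero square at \<open>v\<close>. Every other normal in \<open>P\<close> is then a positive
    multiple of that value, since \<open>\<nu> E\<close> vanishes at \<open>v\<close>.\<close>
  define v where "v = (\<nu> F \<bullet> z) *\<^sub>R z"
  have v: "\<nu> E \<bullet> v = 0" "\<nu> F \<bullet> v > 0" using z EF by (auto simp: v_def mem_iff)
  have "0 < \<nu> G \<bullet> v" if G: "G \<in> P - {E}" for G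
  proof -
    obtain s where s: "0 \<le> s" "\<nu> G = (1 - s) *\<^sub>R \<nu> E + s *\<^sub>R \<nu> F"
      using assms G unfolding extremes_def by blast
    have "s \<noteq> 0" using s normal_inj[of G E] G EF by auto
    then show ?thesis using s v by (simp add: inner_add_left)
  qed
  moreover have "v \<in> E" using v EF(1) by (simp add: mem_iff)
  ultimately show ?thesis using EF(4) mem_pencil_left[OF EF(1)] by (auto simp: basic_def)
qed

lemma extremes_strict:
  assumes "extremes P E F" "G \<in> P" "G \<noteq> E" "G \<noteq> F"
  obtains s where "0 < s" "s < 1" "\<nu> G = (1 - s) *\<^sub>R \<nu> E + s *\<^sub>R \<nu> F"
proof -
  have EF: "E \<in> A" "F \<in> A" "G \<in> A" using assms by (auto simp: extremes_def)
  obtain s where s: "0 \<le> s" "s \<le> 1" "\<nu> G = (1 - s) *\<^sub>R \<nu> E + s *\<^sub>R \<nu> F"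
    using assms unfolding extremes_def by blast
  have "s \<noteq> 0"
  proof
    assume "s = 0"
    then have "\<nu> G = \<nu> E" using s(3) by simp
    then show False using normal_inj EF assms(3) by blast
  qed
  moreover have "s \<noteq> 1"
  proof
    assume "s = 1"
    then have "\<nu> G = \<nu> F" using s(3) by simp
    then show False using normal_inj EF assms(4) by blast
  qed
  ultimately show thesis using s that[of s] by linarith
qed

text \<open>A normal strictly between the extreme ones is positive wherever both of these are, so it
  cannot vanish at a witness of basicness.\<close>

lemma basic_iff_extreme:
  assumes "extremes P E F"
  shows "basic P G \<longleftrightarrow> G = E \<or> G = F"
proof
  assume "G = E \<or> G = F"
  then show "basic P G" using extremes_basic assms extremes_sym by blast
next
  assume G: "basic P G"
  then obtain v where v: "v \<in> G" "\<And>K. K \<in> P - {G} \<Longrightarrow> 0 < \<nu> K \<bullet> v" by (auto simp: basic_def)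
  show "G = E \<or> G = F"
  proof (rule ccontr)
    assume ne: "\<not> (G = E \<or> G = F)"
    have GP: "G \<in> P" using G by (auto simp: basic_def)
    obtain s where s: "0 < s" "s < 1" "\<nu> G = (1 - s) *\<^sub>R \<nu> E + s *\<^sub>R \<nu> F"
      using extremes_strict[OF assms GP] ne by metis
    have "E \<in> P" "F \<in> P" "G \<in> A"
      using assms GP mem_pencil_left mem_pencil_right by (auto simp: extremes_def)
    then have "0 < \<nu> E \<bullet> v" "0 < \<nu> F \<bullet> v" "\<nu> G \<bullet> v = 0" using v ne by (auto simp: mem_iff)
    moreover have "0 < (1 - s) * (\<nu> E \<bullet> v) + s * (\<nu> F \<bullet> v)"
      using s calculation by (intro add_pos_pos mult_pos_pos) auto
    ultimately show False using s by (simp add: inner_add_left)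
  qed
qed

section \<open>Cutting, and points of a hyperplane off everything that cuts it\<close>

definition cut :: "'a set \<Rightarrow> 'a set \<Rightarrow> bool" where
  "cut H K \<longleftrightarrow> H \<in> A \<and> K \<in> A \<and> H \<noteq> K \<and> basic (pencil H K) H \<and> \<not> basic (pencil H K) K"

text \<open>The cutting hyperplane is one extreme of the pencil and \<open>K'\<close> is the other;
  \<open>G\<close> is not basic, so its normal lies strictly inside the segment.\<close>

lemma cut_strictly_between:
  assumes "cut K G"
  obtains K' s where "K' \<in> pencil K G" "0 < s" "s < 1" "\<nu> G = (1 - s) *\<^sub>R \<nu> K + s *\<^sub>R \<nu> K'"
proof -
  have KG: "K \<in> A" "G \<in> A" "K \<noteq> G" "basic (pencil K G) K" "\<not> basic (pencil K G) G"
    using assms by (auto simp: cut_def)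
  obtain E F where EF: "extremes (pencil K G) E F" using pencil_extremes[OF KG(1-3)] .
  obtain K' where K': "extremes (pencil K G) K K'"
    using basic_iff_extreme[OF EF, THEN iffD1, OF KG(4)]
  proof
    assume "K = E" then show thesis using that EF by simp
  next
    assume "K = F" then show thesis using that extremes_sym[OF EF] by simp
  qed
  obtain s where "0 < s" "s < 1" "\<nu> G = (1 - s) *\<^sub>R \<nu> K + s *\<^sub>R \<nu> K'"
    using extremes_strict[OF K' mem_pencil_right[OF KG(2)]] KG basic_iff_extreme[OF K'] by metis
  moreover have "K' \<in> pencil K G" using K' mem_pencil_right by (auto simp: extremes_def)
  ultimately show thesis using that by blast
qed

text \<open>Such points make up the set whose components have the shards in \<open>H\<close> as
  closures; every shard will be named by one of them.\<close>

definition uncut :: "'a set \<Rightarrow> 'a \<Rightarrow> bool" where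
  "uncut H w \<longleftrightarrow> H \<in> A \<and> w \<in> H \<and> (\<forall>K. cut K H \<longrightarrow> w \<notin> K)"

text \<open>Otherwise an extreme member of the pencil would cut \<open>H\<close>, and it contains
  \<open>H \<inter> G\<close>, hence \<open>w\<close>.\<close>

lemma basic_at_uncut_point:
  assumes unc: "uncut H w" and G: "G \<in> A" "H \<noteq> G" "w \<in> G"
  shows "basic (pencil H G) H"
proof (rule ccontr)
  have w: "w \<in> H" and HG: "H \<in> A" "G \<in> A" "H \<noteq> G" "w \<in> G"
    using unc G by (auto simp: uncut_def)
  assume nb: "\<not> basic (pencil H G) H"
  obtain E F where EF: "extremes (pencil H G) E F" using pencil_extremes[OF HG(1-3)] .
  have E: "E \<in> pencil H G" using EF mem_pencil_left by (auto simp: extremes_def)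
  have EA: "E \<in> A" using E by auto
  have ne: "E \<noteq> H" using nb extremes_basic[OF EF] by auto
  have "pencil E H = pencil H G"
    by (rule pencil_eqI[OF HG(1,2) E mem_pencil_left[OF HG(1)] ne])
  then have "cut E H" using nb extremes_basic[OF EF] EA HG ne by (simp add: cut_def)
  moreover have "w \<in> E" using E w HG by (auto simp: pencil_def)
  ultimately show False using unc by (auto simp: uncut_def)
qed

definition generic :: "'a \<Rightarrow> bool" where
  "generic y \<longleftrightarrow> (\<forall>H\<in>A. \<nu> H \<bullet> y \<noteq> 0)"

text \<open>A generic \<open>y\<close> stands for its region. The point \<open>v\<close> is in the
  relative interior of the facet in \<open>H\<close>: it is on the side of \<open>y\<close> for
  every other hyperplane.\<close>

definition wall :: "'a \<Rightarrow> 'a set \<Rightarrow> bool" where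
  "wall y H \<longleftrightarrow> H \<in> A \<and> (\<exists>v\<in>H. \<forall>K\<in>A - {H}. 0 < (\<nu> K \<bullet> v) * (\<nu> K \<bullet> y))"

text \<open>All normals take the value 1 at \<open>b\<close>, so a small step in direction
  \<open>b\<close> leaves every hyperplane through \<open>v\<close> on the positive side and keeps
  the other signs.\<close>

lemma base_perturbation:
  obtains e where "e > 0" "\<And>K. K \<in> A \<Longrightarrow> v \<in> K \<Longrightarrow> \<nu> K \<bullet> (v + e *\<^sub>R b) > 0"
    "\<And>K. K \<in> A \<Longrightarrow> v \<notin> K \<Longrightarrow> 0 < (\<nu> K \<bullet> (v + e *\<^sub>R b)) * (\<nu> K \<bullet> v)"
    "generic (v + e *\<^sub>R b)"
proof -
  obtain e where e: "e > 0" "\<forall>n\<in>\<nu> ` A. n \<bullet> v \<noteq> 0 \<longrightarrow> 0 < (n \<bullet> (v + e *\<^sub>R b)) * (n \<bullet> v)"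
    using exists_small_perturbation[of "\<nu> ` A" v b] finite_A by auto
  have 1: "\<nu> K \<bullet> (v + e *\<^sub>R b) > 0" if "K \<in> A" "v \<in> K" for K
    using that e(1) by (simp add: mem_iff inner_add_right normal_base)
  have 2: "0 < (\<nu> K \<bullet> (v + e *\<^sub>R b)) * (\<nu> K \<bullet> v)" if "K \<in> A" "v \<notin> K" for K
    using that e(2) by (simp add: mem_iff)
  have "generic (v + e *\<^sub>R b)"
    unfolding generic_def using 1 2 by (metis less_irrefl mult_zero_left)
  with e(1) 1 2 show thesis using that by blast
qed

end

section \<open>Faces of a simplicial region, its walls, and uncut hyperplanes as walls\<close>

section \<open>Walls of simplicial regions\<close>

locale simplicial_based_arrangement = based_arrangement +
  assumes simplicial: "generic y \<Longrightarrow> simplicial_cone (closed_cell UNIV (\<nu> ` A) y)"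
begin

definition dual_coordinates :: "'a \<Rightarrow> 'a set \<Rightarrow> ('a \<Rightarrow> 'a) \<Rightarrow> bool" where
  "dual_coordinates y S f \<longleftrightarrow> finite S \<and>
     (\<forall>s\<in>S. \<forall>t\<in>S. f s \<bullet> t = (if s = t then 1 else 0)) \<and>
     closed_cell UNIV (\<nu> ` A) y = {x. \<forall>s\<in>S. 0 \<le> f s \<bullet> x}"

lemma dual_coordinates_exist:
  assumes "generic y"
  obtains S f where "dual_coordinates y S f"
proof -
  have y: "\<And>n. n \<in> \<nu> ` A \<Longrightarrow> n \<bullet> y \<noteq> 0" using assms by (auto simp: generic_def)
  have "rel_interior (closed_cell UNIV (\<nu> ` A) y) = cell UNIV (\<nu> ` A) y"
    by (rule rel_interior_closed_cell) (use finite_A y in auto)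
  moreover have "affine hull (closed_cell UNIV (\<nu> ` A) y) = UNIV"
    by (rule affine_hull_closed_cell) (use finite_A y in auto)
  ultimately have "interior (closed_cell UNIV (\<nu> ` A) y) = cell UNIV (\<nu> ` A) y"
    by (simp add: rel_interior_interior)
  then have "interior (closed_cell UNIV (\<nu> ` A) y) \<noteq> {}"
    using cell_self[of y UNIV, OF UNIV_I y] by auto
  then obtain S f where "finite S" "closed_cell UNIV (\<nu> ` A) y = {x. \<forall>s\<in>S. 0 \<le> f s \<bullet> x}"
    "\<And>s t. s \<in> S \<Longrightarrow> t \<in> S \<Longrightarrow> f s \<bullet> t = (if s = t then 1 else 0)"
    using simplicial_cone_dual[OF simplicial[OF assms]] by blast
  then have "dual_coordinates y S f" by (simp add: dual_coordinates_def)
  then show thesis using that by blast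
qed

context
  fixes y S f
  assumes y: "generic y" and coord: "dual_coordinates y S f"
begin

lemma finite_rays: "finite S"
  and dual_rays: "s \<in> S \<Longrightarrow> t \<in> S \<Longrightarrow> f s \<bullet> t = (if s = t then 1 else 0)"
  and region_coordinates: "(\<forall>H\<in>A. 0 \<le> (\<nu> H \<bullet> x) * (\<nu> H \<bullet> y)) \<longleftrightarrow> (\<forall>s\<in>S. 0 \<le> f s \<bullet> x)"
proof -
  show "finite S" "s \<in> S \<Longrightarrow> t \<in> S \<Longrightarrow> f s \<bullet> t = (if s = t then 1 else 0)"
    using coord by (auto simp: dual_coordinates_def)
  have "x \<in> closed_cell UNIV (\<nu> ` A) y \<longleftrightarrow> x \<in> {x. \<forall>s\<in>S. 0 \<le> f s \<bullet> x}"
    using coord by (simp add: dual_coordinates_def)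
  then show "(\<forall>H\<in>A. 0 \<le> (\<nu> H \<bullet> x) * (\<nu> H \<bullet> y)) \<longleftrightarrow> (\<forall>s\<in>S. 0 \<le> f s \<bullet> x)"
    by (simp add: closed_cell_def)
qed

lemma ray_nonneg:
  assumes "H \<in> A" "s \<in> S"
  shows "0 \<le> (\<nu> H \<bullet> s) * (\<nu> H \<bullet> y)"
  using region_coordinates[of s] dual_rays assms by auto

text \<open>Multiplied by its value at \<open>y\<close>, the normal is nonnegative on the region of
  \<open>y\<close>, so it expands in the dual coordinates.\<close>

lemma normal_expansion:
  assumes "H \<in> A"
  shows "(\<nu> H \<bullet> x) * (\<nu> H \<bullet> y) = (\<Sum>s\<in>S. (f s \<bullet> x) * ((\<nu> H \<bullet> s) * (\<nu> H \<bullet> y)))"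
proof -
  have "((\<nu> H \<bullet> y) *\<^sub>R \<nu> H) \<bullet> x = (\<Sum>s\<in>S. (f s \<bullet> x) * (((\<nu> H \<bullet> y) *\<^sub>R \<nu> H) \<bullet> s))"
  proof (rule nonneg_on_dual_cone_expansion[OF finite_rays dual_rays])
    fix x assume "\<And>s. s \<in> S \<Longrightarrow> 0 \<le> f s \<bullet> x"
    then show "0 \<le> ((\<nu> H \<bullet> y) *\<^sub>R \<nu> H) \<bullet> x"
      using region_coordinates[of x] assms by (auto simp: mult.commute)
  qed
  then show ?thesis by (simp add: mult.commute)
qed

text \<open>The sum of the rays outside \<open>T\<close> is a relative interior point of the face on
  which the coordinates in \<open>T\<close> vanish. If a normal vanishes there, all its values on
  these rays, being of one sign, are zero, so it vanishes wherever the coordinates in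
  \<open>T\<close> do.\<close>

lemma face_point:
  assumes "T \<subseteq> S"
  defines "v \<equiv> (\<Sum>t\<in>S - T. t)"
  shows "\<And>s. s \<in> S \<Longrightarrow> f s \<bullet> v = (if s \<in> T then 0 else 1)"
    and "\<And>K. K \<in> A \<Longrightarrow> 0 \<le> (\<nu> K \<bullet> v) * (\<nu> K \<bullet> y)"
    and "\<And>K x. K \<in> A \<Longrightarrow> \<nu> K \<bullet> v = 0 \<Longrightarrow> (\<And>s. s \<in> T \<Longrightarrow> f s \<bullet> x = 0) \<Longrightarrow> \<nu> K \<bullet> x = 0"
proof -
  show 1: "f s \<bullet> v = (if s \<in> T then 0 else 1)" if s: "s \<in> S" for s
  proof -
    have "f s \<bullet> v = (\<Sum>t\<in>S - T. if s = t then 1 else 0)"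
      unfolding v_def inner_sum_right by (intro sum.cong refl) (use dual_rays s in auto)
    then show ?thesis using finite_rays s by auto
  qed
  then show "0 \<le> (\<nu> K \<bullet> v) * (\<nu> K \<bullet> y)" if "K \<in> A" for K
    using region_coordinates[of v] that by auto
  fix K x assume K: "K \<in> A" "\<nu> K \<bullet> v = 0" and x: "\<And>s. s \<in> T \<Longrightarrow> f s \<bullet> x = 0"
  have "(\<Sum>t\<in>S - T. (\<nu> K \<bullet> t) * (\<nu> K \<bullet> y)) = 0"
    using K(2) by (simp add: v_def inner_sum_right flip: sum_distrib_right)
  then have zero: "\<forall>t\<in>S - T. (\<nu> K \<bullet> t) * (\<nu> K \<bullet> y) = 0"
    using sum_nonneg_eq_0_iff[of "S - T" "\<lambda>t. (\<nu> K \<bullet> t) * (\<nu> K \<bullet> y)"] finite_rays ray_nonneg[OF K(1)]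
    by simp
  have "(\<Sum>t\<in>S. (f t \<bullet> x) * ((\<nu> K \<bullet> t) * (\<nu> K \<bullet> y))) = 0"
  proof (intro sum.neutral ballI)
    fix t assume "t \<in> S"
    then show "(f t \<bullet> x) * ((\<nu> K \<bullet> t) * (\<nu> K \<bullet> y)) = 0"
      using zero x by (cases "t \<in> T") auto
  qed
  then have "(\<nu> K \<bullet> x) * (\<nu> K \<bullet> y) = 0"
    using normal_expansion[OF K(1), of x] by (rule trans[rotated])
  then show "\<nu> K \<bullet> x = 0" using y K by (auto simp: generic_def)
qed

text \<open>Some member of \<open>A\<close> passes through the interior point \<open>v\<close> of
  the facet opposite to \<open>s\<close>: otherwise a small step in direction \<open>- s\<close>
  would stay in the region although it makes the coordinate of \<open>s\<close> negative.\<close>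

lemma coordinate_hyperplane:
  assumes s: "s \<in> S"
  obtains K where "wall y K" "K = {x. f s \<bullet> x = 0}"
proof -
  define v where "v = (\<Sum>t\<in>S - {s}. t)"
  have sub: "{s} \<subseteq> S" using s by auto
  note v = face_point[OF sub, folded v_def]
  have zero: "K = {x. f s \<bullet> x = 0}" if K: "K \<in> A" "\<nu> K \<bullet> v = 0" for K
  proof (intro set_eqI iffI)
    fix x assume "x \<in> {x. f s \<bullet> x = 0}"
    then show "x \<in> K" using v(3)[OF K] K(1) by (simp add: mem_iff)
  next
    fix x assume x: "x \<in> K"
    \<comment> \<open>Removing the component of \<open>b\<close> along \<open>s\<close> gives a zero
      of \<open>\<nu> K\<close>. As \<open>\<nu> K\<close> is 1 at \<open>b\<close>, it cannot
      vanish at \<open>s\<close>.\<close>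
    define u where "u = b - (f s \<bullet> b) *\<^sub>R s"
    have "f s \<bullet> u = 0" using dual_rays[OF s s] by (simp add: u_def inner_diff_right)
    then have "\<nu> K \<bullet> u = 0" using v(3)[OF K, of u] by simp
    then have ne: "\<nu> K \<bullet> s \<noteq> 0" using normal_base[OF K(1)] by (auto simp: u_def inner_diff_right)
    have "f s \<bullet> (x - (f s \<bullet> x) *\<^sub>R s) = 0" using dual_rays[OF s s] by (simp add: inner_diff_right)
    then have "\<nu> K \<bullet> (x - (f s \<bullet> x) *\<^sub>R s) = 0" using v(3)[OF K] by simp
    then show "x \<in> {x. f s \<bullet> x = 0}" using x K(1) ne by (simp add: mem_iff inner_diff_right)
  qed
  have "\<exists>K\<in>A. \<nu> K \<bullet> v = 0"
  proof (rule ccontr)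
    assume "\<not> (\<exists>K\<in>A. \<nu> K \<bullet> v = 0)"
    then have ne: "\<And>K. K \<in> A \<Longrightarrow> \<nu> K \<bullet> v \<noteq> 0" by auto
    obtain e where e: "e > 0" "\<forall>n\<in>\<nu> ` A. n \<bullet> v \<noteq> 0 \<longrightarrow> 0 < (n \<bullet> (v + e *\<^sub>R (- s))) * (n \<bullet> v)"
      using exists_small_perturbation[of "\<nu> ` A" v "- s"] finite_A by auto
    have "0 \<le> (\<nu> K \<bullet> (v + e *\<^sub>R (- s))) * (\<nu> K \<bullet> y)" if K: "K \<in> A" for K
    proof -
      have "0 < (\<nu> K \<bullet> (v + e *\<^sub>R (- s))) * (\<nu> K \<bullet> v)" using e(2) K ne by auto
      moreover have "0 < (\<nu> K \<bullet> v) * (\<nu> K \<bullet> y)"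
        using v(2)[OF K] ne[OF K] y K by (auto simp: generic_def less_le)
      ultimately show ?thesis by (auto simp: zero_less_mult_iff zero_le_mult_iff)
    qed
    then have "0 \<le> f s \<bullet> (v + e *\<^sub>R (- s))" using region_coordinates s by blast
    then show False using v(1)[OF s] dual_rays[OF s s] e(1) by (simp add: inner_diff_right)
  qed
  then obtain K where K: "K \<in> A" "\<nu> K \<bullet> v = 0" by auto
  have "0 < (\<nu> L \<bullet> v) * (\<nu> L \<bullet> y)" if L: "L \<in> A - {K}" for L
  proof -
    have "\<nu> L \<bullet> v \<noteq> 0" using zero[OF K] zero[of L] L by auto
    then show ?thesis using v(2)[of L] y L by (auto simp: generic_def less_le)
  qed
  then have "wall y K" using K mem_iff by (auto simp: wall_def)
  then show thesis using that zero[OF K] by blast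
qed

text \<open>The facet point \<open>v\<close> has a zero coordinate, since otherwise one could cross
  \<open>H\<close> near \<open>v\<close> without leaving the region. The coordinate hyperplane
  through \<open>v\<close> must be \<open>H\<close>, the only member of \<open>A\<close> containing
  \<open>v\<close>.\<close>

lemma wall_coordinate:
  assumes "wall y H"
  obtains s where "s \<in> S" "H = {x. f s \<bullet> x = 0}"
proof -
  obtain v where HA: "H \<in> A" and v: "v \<in> H" "\<And>K. K \<in> A - {H} \<Longrightarrow> 0 < (\<nu> K \<bullet> v) * (\<nu> K \<bullet> y)"
    using assms by (auto simp: wall_def)
  have "\<forall>K\<in>A. 0 \<le> (\<nu> K \<bullet> v) * (\<nu> K \<bullet> y)"
    using v HA by (metis DiffI less_imp_le mem_iff mult_zero_left order_refl singletonD)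
  then have ge: "\<And>s. s \<in> S \<Longrightarrow> 0 \<le> f s \<bullet> v" using region_coordinates by blast
  have "\<exists>s\<in>S. f s \<bullet> v = 0"
  proof (rule ccontr)
    assume "\<not> (\<exists>s\<in>S. f s \<bullet> v = 0)"
    then have gt: "\<And>s. s \<in> S \<Longrightarrow> 0 < f s \<bullet> v" using ge by (metis less_le)
    \<comment> \<open>This direction crosses \<open>H\<close> away from \<open>y\<close>, because
      \<open>\<nu> H\<close> is 1 at \<open>b\<close>.\<close>
    let ?z = "- ((\<nu> H \<bullet> y) *\<^sub>R b)"
    obtain e where e: "e > 0" "\<forall>n\<in>f ` S. n \<bullet> v \<noteq> 0 \<longrightarrow> 0 < (n \<bullet> (v + e *\<^sub>R ?z)) * (n \<bullet> v)"
      using exists_small_perturbation[of "f ` S" v ?z] finite_rays by auto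
    have "0 \<le> f s \<bullet> (v + e *\<^sub>R ?z)" if s: "s \<in> S" for s
    proof -
      have "0 < (f s \<bullet> (v + e *\<^sub>R ?z)) * (f s \<bullet> v)" using e(2) gt[OF s] s by auto
      then show ?thesis using gt[OF s] zero_less_mult_pos2 by (metis less_imp_le)
    qed
    then have "0 \<le> (\<nu> H \<bullet> (v + e *\<^sub>R ?z)) * (\<nu> H \<bullet> y)" using region_coordinates HA by blast
    moreover have "(\<nu> H \<bullet> (v + e *\<^sub>R ?z)) * (\<nu> H \<bullet> y) = - (e * (\<nu> H \<bullet> y)\<^sup>2)"
      using v(1) HA by (simp add: mem_iff normal_base inner_diff_right power2_eq_square)
    moreover have "0 < e * (\<nu> H \<bullet> y)\<^sup>2" using e(1) y HA by (auto simp: generic_def)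
    ultimately show False by linarith
  qed
  then obtain s where s: "s \<in> S" "f s \<bullet> v = 0" by auto
  obtain K where K: "wall y K" "K = {x. f s \<bullet> x = 0}" using coordinate_hyperplane[OF s(1)] .
  have "v \<in> K" "K \<in> A" using s K by (auto simp: wall_def)
  then have "K = H" using v(2)[of K] mem_iff[of K v] by auto
  then show thesis using that s K by blast
qed

end

text \<open>Two walls are two coordinate hyperplanes of the simplicial cone, so they share a
  codimension-2 face. A member of \<open>A\<close> through the relative interior point
  \<open>v\<close> of that face contains all of \<open>H \<inter> G\<close>.\<close>

lemma walls_meet:
  assumes "generic y" "wall y H" "wall y G" "H \<noteq> G"
  obtains v where "v \<in> H" "v \<in> G" "\<And>K. K \<in> A \<Longrightarrow> K \<notin> pencil H G \<Longrightarrow> 0 < (\<nu> K \<bullet> v) * (\<nu> K \<bullet> y)"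
proof -
  obtain S f where coord: "dual_coordinates y S f" using dual_coordinates_exist[OF assms(1)] .
  note facts = assms(1) coord
  obtain s where s: "s \<in> S" "H = {x. f s \<bullet> x = 0}" using wall_coordinate[OF facts assms(2)] .
  obtain t where t: "t \<in> S" "G = {x. f t \<bullet> x = 0}" using wall_coordinate[OF facts assms(3)] .
  define v where "v = (\<Sum>r\<in>S - {s, t}. r)"
  have sub: "{s, t} \<subseteq> S" using s t by auto
  note v = face_point[OF facts sub, folded v_def]
  have "0 < (\<nu> K \<bullet> v) * (\<nu> K \<bullet> y)" if K: "K \<in> A" "K \<notin> pencil H G" for K
  proof -
    have "\<nu> K \<bullet> v \<noteq> 0"
    proof
      assume "\<nu> K \<bullet> v = 0"
      then have "H \<inter> G \<subseteq> K" using v(3)[OF K(1)] s t mem_iff[OF K(1)] by auto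
      then show False using K by (auto simp: pencil_def)
    qed
    then show ?thesis using v(2)[OF K(1)] assms(1) K(1) by (auto simp: generic_def less_le)
  qed
  then show thesis using that[of v] v(1) s t by auto
qed

text \<open>The point \<open>y'\<close> is outside the region of \<open>y\<close>, so one of its
  coordinates is negative; the normal of the corresponding wall is proportional to that
  coordinate.\<close>

lemma separating_wall:
  assumes "generic y" "K \<in> A" "(\<nu> K \<bullet> y') * (\<nu> K \<bullet> y) < 0" "generic y'"
  obtains G where "wall y G" "(\<nu> G \<bullet> y') * (\<nu> G \<bullet> y) < 0"
proof -
  obtain S f where coord: "dual_coordinates y S f" using dual_coordinates_exist[OF assms(1)] .
  note facts = assms(1) coord
  obtain s where s: "s \<in> S" "f s \<bullet> y' < 0"
    using region_coordinates[OF facts, of y'] assms(2,3) by (meson not_le)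
  obtain G where G: "wall y G" "G = {x. f s \<bullet> x = 0}" using coordinate_hyperplane[OF facts s(1)] .
  have GA: "G \<in> A" using G by (auto simp: wall_def)
  have "f s \<bullet> (y' - (f s \<bullet> y') *\<^sub>R s) = 0"
    using dual_rays[OF facts s(1) s(1)] by (simp add: inner_diff_right)
  then have "\<nu> G \<bullet> (y' - (f s \<bullet> y') *\<^sub>R s) = 0" using G(2) mem_iff[OF GA] by blast
  then have "(\<nu> G \<bullet> y') * (\<nu> G \<bullet> y) = (f s \<bullet> y') * ((\<nu> G \<bullet> s) * (\<nu> G \<bullet> y))"
    by (simp add: inner_diff_right)
  moreover have "\<dots> \<le> 0"
    using s ray_nonneg[OF facts GA s(1)] by (simp add: mult_nonpos_nonneg)
  moreover have "(\<nu> G \<bullet> y') * (\<nu> G \<bullet> y) \<noteq> 0" using assms GA by (auto simp: generic_def)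
  ultimately have "(\<nu> G \<bullet> y') * (\<nu> G \<bullet> y) < 0" by linarith
  with G(1) show thesis using that by blast
qed

text \<open>The signs at \<open>v\<close> are those at \<open>w + e *\<^sub>R b\<close> for small
  \<open>e > 0\<close>, so the conclusion says that \<open>H\<close> is a wall of that region. The
  proof is a descent on the number of hyperplanes through \<open>w\<close> with \<open>v\<close> on
  their negative side.\<close>

lemma uncut_wall:
  assumes unc: "uncut H w"
  obtains v where "v \<in> H" "\<And>K. K \<in> A \<Longrightarrow> K \<noteq> H \<Longrightarrow> w \<in> K \<Longrightarrow> 0 < \<nu> K \<bullet> v"
    "\<And>K. K \<in> A \<Longrightarrow> w \<notin> K \<Longrightarrow> 0 < (\<nu> K \<bullet> v) * (\<nu> K \<bullet> w)"
proof -
  have HA: "H \<in> A" and wH: "w \<in> H" using unc by (auto simp: uncut_def)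
  have subH: "subspace H" by (rule subspace_hyperplane_mem[OF HA])
  \<comment> \<open>Points of \<open>V\<close> represent the facets in \<open>H\<close> of regions
    whose closures contain \<open>w\<close>; \<open>neg v\<close> collects what still separates such
    a facet from the desired one.\<close>
  define V where "V = {v \<in> H. (\<forall>K\<in>A - {H}. \<nu> K \<bullet> v \<noteq> 0) \<and>
    (\<forall>K\<in>A. w \<notin> K \<longrightarrow> 0 < (\<nu> K \<bullet> v) * (\<nu> K \<bullet> w))}"
  define neg where "neg v = {K \<in> A. w \<in> K \<and> \<nu> K \<bullet> v < 0}" for v
  have fin_neg: "finite (neg v)" for v using finite_A by (auto simp: neg_def)
  have "\<exists>z\<in>H. \<forall>n\<in>\<nu> ` (A - {H}). n \<bullet> z \<noteq> 0"
  proof (rule convex_avoids_hyperplanes)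
    fix n assume "n \<in> \<nu> ` (A - {H})"
    then obtain K where K: "K \<in> A" "K \<noteq> H" "n = \<nu> K" by auto
    then have "\<not> H \<subseteq> K" using hyperplane_subset_eq HA by auto
    then show "\<exists>x\<in>H. n \<bullet> x \<noteq> 0" using K mem_iff by auto
  qed (use finite_A wH subH in \<open>auto intro: subspace_imp_convex\<close>)
  then obtain z where z: "z \<in> H" "\<And>K. K \<in> A \<Longrightarrow> K \<noteq> H \<Longrightarrow> \<nu> K \<bullet> z \<noteq> 0" by auto
  obtain e where e: "e > 0" "\<forall>n\<in>\<nu> ` A. n \<bullet> w \<noteq> 0 \<longrightarrow> 0 < (n \<bullet> (w + e *\<^sub>R z)) * (n \<bullet> w)"
    using exists_small_perturbation[of "\<nu> ` A" w z] finite_A by auto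
  have "w + e *\<^sub>R z \<in> V"
  proof -
    have "w + e *\<^sub>R z \<in> H" using wH z subH by (intro subspace_add subspace_scale)
    moreover have "0 < (\<nu> K \<bullet> (w + e *\<^sub>R z)) * (\<nu> K \<bullet> w)" if "K \<in> A" "w \<notin> K" for K
      using that e(2) mem_iff by auto
    moreover have "\<nu> K \<bullet> (w + e *\<^sub>R z) \<noteq> 0" if K: "K \<in> A" "K \<noteq> H" for K
    proof (cases "w \<in> K")
      case True
      then show ?thesis using z(2)[OF K] e(1) K(1) by (simp add: mem_iff inner_add_right)
    next
      case False
      then show ?thesis using calculation(2)[OF K(1)] by auto
    qed
    ultimately show ?thesis by (auto simp: V_def)
  qed
  then obtain v where v: "v \<in> V" and least: "\<And>u. u \<in> V \<Longrightarrow> card (neg v) \<le> card (neg u)"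
    using ex_has_least_nat[of "\<lambda>v. v \<in> V" _ "\<lambda>v. card (neg v)"] by blast
  have vH: "v \<in> H" and v_ne: "\<And>K. K \<in> A \<Longrightarrow> K \<noteq> H \<Longrightarrow> \<nu> K \<bullet> v \<noteq> 0"
    and v_w: "\<And>K. K \<in> A \<Longrightarrow> w \<notin> K \<Longrightarrow> 0 < (\<nu> K \<bullet> v) * (\<nu> K \<bullet> w)"
    using v by (auto simp: V_def)
  have "neg v = {}"
  proof (rule ccontr)
    assume "neg v \<noteq> {}"
    then obtain N where N: "N \<in> A" "w \<in> N" "\<nu> N \<bullet> v < 0" by (auto simp: neg_def)
    obtain d where d: "d > 0" "\<And>K. K \<in> A \<Longrightarrow> v \<in> K \<Longrightarrow> \<nu> K \<bullet> (v + d *\<^sub>R b) > 0"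
      "\<And>K. K \<in> A \<Longrightarrow> v \<notin> K \<Longrightarrow> 0 < (\<nu> K \<bullet> (v + d *\<^sub>R b)) * (\<nu> K \<bullet> v)"
      "generic (v + d *\<^sub>R b)"
      using base_perturbation[of v] by blast
    obtain c where c: "c > 0" "\<And>K. K \<in> A \<Longrightarrow> w \<in> K \<Longrightarrow> \<nu> K \<bullet> (w + c *\<^sub>R b) > 0"
      "\<And>K. K \<in> A \<Longrightarrow> w \<notin> K \<Longrightarrow> 0 < (\<nu> K \<bullet> (w + c *\<^sub>R b)) * (\<nu> K \<bullet> w)"
      "generic (w + c *\<^sub>R b)"
      using base_perturbation[of w] by blast
    \<comment> \<open>Both points are on the base side of \<open>H\<close>: \<open>y\<close> lies in
      a region with the current facet, and \<open>y0\<close> in the target region.\<close>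
    define y where "y = v + d *\<^sub>R b"
    define y0 where "y0 = w + c *\<^sub>R b"
    have y_v: "0 < (\<nu> K \<bullet> v) * (\<nu> K \<bullet> y)" if "K \<in> A" "K \<noteq> H" for K
      using d(3)[OF that(1)] v_ne[OF that] that mem_iff by (simp add: y_def mult.commute)
    have y_H: "0 < \<nu> H \<bullet> y" using d(2)[OF HA vH] by (simp add: y_def)
    have "N \<noteq> H" using N vH HA mem_iff by auto
    then have "\<nu> N \<bullet> y < 0" using y_v[OF N(1)] N(3) by (auto simp: zero_less_mult_iff)
    moreover have "0 < \<nu> N \<bullet> y0" using c(2) N by (simp add: y0_def)
    ultimately have "(\<nu> N \<bullet> y0) * (\<nu> N \<bullet> y) < 0" by (simp add: mult_pos_neg)
    then obtain G where G: "wall y G" "(\<nu> G \<bullet> y0) * (\<nu> G \<bullet> y) < 0"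
      using separating_wall[of y N y0] N d(4) c(4) by (auto simp: y_def y0_def)
    have GA: "G \<in> A" using G by (auto simp: wall_def)
    \<comment> \<open>Hyperplanes missing \<open>w\<close> have the sign of \<open>w\<close> at both
      \<open>y\<close> and \<open>y0\<close>, so they separate nothing.\<close>
    have wG: "w \<in> G"
    proof (rule ccontr)
      assume nw: "w \<notin> G"
      then have "G \<noteq> H" using wH by auto
      then have "0 < (\<nu> G \<bullet> v) * (\<nu> G \<bullet> y)" using y_v GA by blast
      moreover have "0 < (\<nu> G \<bullet> v) * (\<nu> G \<bullet> w)" using v_w GA nw by blast
      moreover have "0 < (\<nu> G \<bullet> y0) * (\<nu> G \<bullet> w)" using c(3) GA nw by (simp add: y0_def)
      ultimately show False using G(2) by (auto simp: zero_less_mult_iff mult_less_0_iff)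
    qed
    have y0_G: "0 < \<nu> G \<bullet> y0" using c(2) GA wG by (simp add: y0_def)
    then have y_G: "\<nu> G \<bullet> y < 0" using G(2) by (auto simp: mult_less_0_iff)
    then have GH: "G \<noteq> H" using y_H by auto
    then have v_G: "\<nu> G \<bullet> v < 0" using y_v[OF GA] y_G by (auto simp: zero_less_mult_iff)
    have "wall y H" using HA vH y_v by (auto simp: wall_def)
    then obtain u where u: "u \<in> H" "u \<in> G"
      "\<And>K. K \<in> A \<Longrightarrow> K \<notin> pencil H G \<Longrightarrow> 0 < (\<nu> K \<bullet> u) * (\<nu> K \<bullet> y)"
      using walls_meet[of y H G] d(4) G(1) GH by (auto simp: y_def)
    \<comment> \<open>Since \<open>H\<close> is basic in its pencil with \<open>G\<close>, there is
      a direction within \<open>H\<close> towards the base side of all the other members.\<close>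
    obtain z where z: "z \<in> H" "\<And>K. K \<in> pencil H G \<Longrightarrow> K \<noteq> H \<Longrightarrow> 0 < \<nu> K \<bullet> z"
      using basic_at_uncut_point[OF unc GA] GH wG by (auto simp: basic_def)
    obtain e where e: "e > 0" "\<forall>n\<in>\<nu> ` A. n \<bullet> u \<noteq> 0 \<longrightarrow> 0 < (n \<bullet> (u + e *\<^sub>R z)) * (n \<bullet> u)"
      using exists_small_perturbation[of "\<nu> ` A" u z] finite_A by auto
    \<comment> \<open>Moving from the codimension-2 face in that direction makes the rest of the
      pencil positive and keeps every other sign of \<open>v\<close>. So \<open>G\<close> leaves the
      negative set and nothing enters it.\<close>
    define x where "x = u + e *\<^sub>R z"
    have x_off: "0 < (\<nu> K \<bullet> x) * (\<nu> K \<bullet> v)" if K: "K \<in> A" "K \<notin> pencil H G" for K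
    proof -
      have "K \<noteq> H" using K mem_pencil_left by auto
      then have "0 < (\<nu> K \<bullet> v) * (\<nu> K \<bullet> y)" using y_v K by blast
      moreover have "0 < (\<nu> K \<bullet> u) * (\<nu> K \<bullet> y)" using u(3) K by blast
      moreover have "0 < (\<nu> K \<bullet> x) * (\<nu> K \<bullet> u)"
        using e(2) K calculation(2) by (auto simp: x_def)
      ultimately show ?thesis by (auto simp: zero_less_mult_iff)
    qed
    have x_on: "0 < \<nu> K \<bullet> x" if K: "K \<in> pencil H G" "K \<noteq> H" for K
    proof -
      have "u \<in> K" "K \<in> A" using u K by (auto simp: pencil_def)
      then show ?thesis using z(2)[OF K] e(1) by (simp add: x_def inner_add_right mem_iff)
    qed
    have "x \<in> H" using u z subH unfolding x_def by (intro subspace_add subspace_scale)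
    moreover have "\<nu> K \<bullet> x \<noteq> 0" if "K \<in> A" "K \<noteq> H" for K
      using x_off[of K] x_on[of K] that by (cases "K \<in> pencil H G") auto
    moreover have "0 < (\<nu> K \<bullet> x) * (\<nu> K \<bullet> w)" if "K \<in> A" "w \<notin> K" for K
    proof -
      have "K \<notin> pencil H G" using that wH wG by (auto simp: pencil_def)
      then show ?thesis using x_off[of K] v_w[of K] that by (auto simp: zero_less_mult_iff)
    qed
    ultimately have "x \<in> V" by (auto simp: V_def)
    moreover have "neg x \<subset> neg v"
    proof
      show "neg x \<subseteq> neg v"
      proof
        fix K assume K: "K \<in> neg x"
        then have "K \<noteq> H" using \<open>x \<in> H\<close> HA mem_iff by (auto simp: neg_def)
        then have "K \<notin> pencil H G" using K x_on[of K] by (auto simp: neg_def)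
        then show "K \<in> neg v" using K x_off[of K] by (auto simp: neg_def zero_less_mult_iff)
      qed
      have "G \<in> neg v" using GA wG v_G by (simp add: neg_def)
      moreover have "G \<notin> neg x"
        using x_on[OF mem_pencil_right[OF GA] GH] by (simp add: neg_def)
      ultimately show "neg x \<noteq> neg v" by auto
    qed
    ultimately show False using least[of x] psubset_card_mono[OF fin_neg, of "neg x" v] by linarith
  qed
  then have "0 < \<nu> K \<bullet> v" if "K \<in> A" "K \<noteq> H" "w \<in> K" for K
    using v_ne[OF that(1,2)] that by (auto simp: neg_def not_less_iff_gr_or_eq)
  then show thesis using that vH v_w by blast
qed

text \<open>Both \<open>H\<close> and \<open>H'\<close> are walls of one region, so there is a point
  \<open>v\<close> of \<open>H \<inter> H'\<close> at which only the pencil vanishes. If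
  \<open>K\<close> were outside the pencil, \<open>\<nu> G\<close> would be a positive combination
  of a positive and a nonnegative value at \<open>v\<close>, although \<open>G\<close> contains
  \<open>v\<close>.\<close>

lemma cutter_in_pencil_of_uncut:
  assumes unc: "uncut H w" "uncut H' w" "H \<noteq> H'"
    and G: "G \<in> pencil H H'" and K: "cut K G" "w \<in> K"
  shows "K \<in> pencil H H'"
proof (rule ccontr)
  assume nK: "K \<notin> pencil H H'"
  obtain c where c: "c > 0" "\<And>K. K \<in> A \<Longrightarrow> w \<in> K \<Longrightarrow> \<nu> K \<bullet> (w + c *\<^sub>R b) > 0"
    "\<And>K. K \<in> A \<Longrightarrow> w \<notin> K \<Longrightarrow> 0 < (\<nu> K \<bullet> (w + c *\<^sub>R b)) * (\<nu> K \<bullet> w)"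
    "generic (w + c *\<^sub>R b)"
    using base_perturbation[of w] by blast
  let ?y = "w + c *\<^sub>R b"
  have wall: "wall ?y L" if L: "uncut L w" for L
  proof -
    obtain v where v: "v \<in> L" "\<And>K. K \<in> A \<Longrightarrow> K \<noteq> L \<Longrightarrow> w \<in> K \<Longrightarrow> 0 < \<nu> K \<bullet> v"
      "\<And>K. K \<in> A \<Longrightarrow> w \<notin> K \<Longrightarrow> 0 < (\<nu> K \<bullet> v) * (\<nu> K \<bullet> w)"
      using uncut_wall[OF L] by blast
    have "0 < (\<nu> M \<bullet> v) * (\<nu> M \<bullet> ?y)" if M: "M \<in> A" "M \<noteq> L" for M
    proof (cases "w \<in> M")
      case True
      then show ?thesis using v(2)[OF M] c(2)[OF M(1)] by simp
    next
      case False
      then show ?thesis using v(3)[OF M(1)] c(3)[OF M(1)] by (auto simp: zero_less_mult_iff)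
    qed
    then show ?thesis using v(1) L by (auto simp: wall_def uncut_def)
  qed
  obtain v where v: "v \<in> H" "v \<in> H'"
    "\<And>M. M \<in> A \<Longrightarrow> M \<notin> pencil H H' \<Longrightarrow> 0 < (\<nu> M \<bullet> v) * (\<nu> M \<bullet> ?y)"
    using walls_meet[OF c(4) wall[OF unc(1)] wall[OF unc(2)] unc(3)] by blast
  obtain K' s where K': "K' \<in> pencil K G" and s: "0 < s" "s < 1"
    "\<nu> G = (1 - s) *\<^sub>R \<nu> K + s *\<^sub>R \<nu> K'"
    using cut_strictly_between[OF K(1)] by blast
  have vG: "\<nu> G \<bullet> v = 0" and wG: "w \<in> G"
    using G v(1,2) unc mem_iff by (auto simp: pencil_def uncut_def)
  have pos: "0 \<le> \<nu> M \<bullet> v" "M \<notin> pencil H H' \<Longrightarrow> 0 < \<nu> M \<bullet> v" if M: "M \<in> A" "w \<in> M" for M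
  proof -
    show gt: "0 < \<nu> M \<bullet> v" if "M \<notin> pencil H H'"
      using v(3)[OF M(1) that] c(2)[OF M] by (rule zero_less_mult_pos2)
    show "0 \<le> \<nu> M \<bullet> v"
    proof (cases "M \<in> pencil H H'")
      case True
      then have "v \<in> M" using v(1,2) by (auto simp: pencil_def)
      then show ?thesis using M mem_iff by auto
    qed (use gt in auto)
  qed
  have "K \<in> A" using K by (auto simp: cut_def)
  \<comment> \<open>The other extreme \<open>K'\<close> contains \<open>K \<inter> G\<close>, hence
    \<open>w\<close>, so its normal is nonnegative at \<open>v\<close>.\<close>
  moreover have "K' \<in> A" "w \<in> K'" using K' K(2) wG by (auto simp: pencil_def)
  ultimately have "0 < \<nu> K \<bullet> v" "0 \<le> \<nu> K' \<bullet> v" using pos K(2) nK by auto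
  then have "0 < (1 - s) * (\<nu> K \<bullet> v) + s * (\<nu> K' \<bullet> v)"
    using s by (intro add_pos_nonneg mult_pos_pos mult_nonneg_nonneg) auto
  then show False using vG s by (simp add: inner_add_left)
qed

end

section \<open>Dimensions, basic hyperplanes and shards expressed through normals and cells\<close>

section \<open>Shards\<close>

context based_arrangement
begin

lemma dim_hyperplane_mem:
  assumes "H \<in> A"
  shows "dim H + 1 = DIM('a)"
proof -
  have "\<nu> H \<noteq> 0" using normal_base[OF assms] by auto
  moreover have "H = {x. \<nu> H \<bullet> x = 0}" using mem_iff[OF assms] by auto
  ultimately have "dim H = DIM('a) - 1" using dim_hyperplane by metis
  then show ?thesis by simp
qed

lemma dim_Int_hyperplanes:
  assumes "H \<in> A" "K \<in> A" "H \<noteq> K"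
  shows "dim (H \<inter> K) + 2 = DIM('a)"
proof -
  obtain z where z: "z \<in> H" "\<nu> K \<bullet> z \<noteq> 0"
    using hyperplane_subset_eq assms mem_iff by blast
  have "{x + y | x y. x \<in> H \<and> y \<in> K} = UNIV"
  proof (intro set_eqI iffI UNIV_I)
    fix x :: 'a
    let ?c = "(\<nu> K \<bullet> x) / (\<nu> K \<bullet> z)"
    have "?c *\<^sub>R z \<in> H" using z subspace_scale[OF subspace_hyperplane_mem[OF assms(1)]] by blast
    moreover have "x - ?c *\<^sub>R z \<in> K" using z assms(2) by (simp add: mem_iff inner_diff_right)
    moreover have "x = ?c *\<^sub>R z + (x - ?c *\<^sub>R z)" by simp
    ultimately show "x \<in> {x + y | x y. x \<in> H \<and> y \<in> K}" by blast
  qed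
  then show ?thesis
    using dim_sums_Int[OF subspace_hyperplane_mem[OF assms(1)] subspace_hyperplane_mem[OF assms(2)]]
      dim_hyperplane_mem[OF assms(1)] dim_hyperplane_mem[OF assms(2)] by (simp add: dim_UNIV)
qed

lemma aff_dim_Int_hyperplanes:
  assumes "H \<in> A" "K \<in> A" "H \<noteq> K"
  shows "aff_dim (H \<inter> K) = int DIM('a) - 2"
  using dim_Int_hyperplanes[OF assms] assms
  by (simp add: aff_dim_subspace subspace_inter subspace_hyperplane_mem)

text \<open>The subspace \<open>U\<close> of a rank-two subarrangement lies in
  \<open>H \<inter> K\<close> and has the same dimension, so it equals it.\<close>

lemma rank_two_containing_iff:
  "rank_two_containing A H K P \<longleftrightarrow> H \<in> A \<and> K \<in> A \<and> H \<noteq> K \<and> P = pencil H K"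
proof
  assume "rank_two_containing A H K P"
  then obtain U where U: "subspace U" "dim U + 2 = DIM('a)" "P = {G \<in> A. U \<subseteq> G}"
    and HK: "H \<noteq> K" "H \<in> P" "K \<in> P"
    by (auto simp: rank_two_containing_def rank_two_subarrangement_def)
  have HKA: "H \<in> A" "K \<in> A" and "U \<subseteq> H \<inter> K" using U HK by auto
  then have "U = H \<inter> K"
    using U dim_Int_hyperplanes[OF HKA HK(1)]
    by (intro subspace_dim_equal) (auto simp: subspace_inter subspace_hyperplane_mem)
  then show "H \<in> A \<and> K \<in> A \<and> H \<noteq> K \<and> P = pencil H K"
    using U HK HKA by (simp add: pencil_def)
next
  assume HK: "H \<in> A \<and> K \<in> A \<and> H \<noteq> K \<and> P = pencil H K"
  have "card {H, K} \<le> card (pencil H K)"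
    using HK finite_A mem_pencil_left mem_pencil_right
    by (intro card_mono) (auto simp: pencil_def)
  then have "card P > 1" using HK by auto
  moreover have "subspace (H \<inter> K)"
    using HK by (simp add: subspace_inter subspace_hyperplane_mem)
  ultimately show "rank_two_containing A H K P"
    using HK dim_Int_hyperplanes[of H K] mem_pencil_left[of H K] mem_pencil_right[of K H]
    by (auto simp: rank_two_containing_def rank_two_subarrangement_def pencil_def
        intro!: exI[of _ "H \<inter> K"])
qed

definition base_region :: "'a set" where
  "base_region = {x. \<forall>H\<in>A. 0 \<le> \<nu> H \<bullet> x}"

lemma regions_subset_eq:
  assumes "P \<subseteq> A"
  shows "regions P = {closed_cell UNIV (\<nu> ` P) w | w. \<forall>n\<in>\<nu> ` P. n \<bullet> w \<noteq> 0}"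
proof -
  have "\<Union>P = (\<Union>n\<in>\<nu> ` P. {x. n \<bullet> x = 0})" using assms mem_iff by auto
  then show ?thesis
    unfolding regions_def using closure_components_eq_closed_cells[of UNIV "\<nu> ` P"] by simp
qed

text \<open>The base region contains \<open>b\<close>, where all normals are positive; this fixes
  every sign of a region of \<open>P\<close> that contains it.\<close>

lemma region_containing_base:
  assumes "P \<subseteq> A"
  shows "R \<in> regions P \<and> base_region \<subseteq> R \<longleftrightarrow> R = {x. \<forall>H\<in>P. 0 \<le> \<nu> H \<bullet> x}"
proof
  assume R: "R \<in> regions P \<and> base_region \<subseteq> R"
  then obtain w where w: "\<forall>n\<in>\<nu> ` P. n \<bullet> w \<noteq> 0" "R = closed_cell UNIV (\<nu> ` P) w"
    using regions_subset_eq[OF assms] by auto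
  have "b \<in> base_region" by (simp add: base_region_def normal_base)
  then have "b \<in> R" using R by auto
  then have pos: "0 < \<nu> H \<bullet> w" if "H \<in> P" for H
    using w that assms normal_base[of H] by (force simp: closed_cell_def less_le)
  have "0 \<le> (\<nu> H \<bullet> x) * (\<nu> H \<bullet> w) \<longleftrightarrow> 0 \<le> \<nu> H \<bullet> x" if "H \<in> P" for H x
    using pos[OF that] by (simp add: zero_le_mult_iff)
  then show "R = {x. \<forall>H\<in>P. 0 \<le> \<nu> H \<bullet> x}"
    by (simp add: w closed_cell_def)
next
  assume R: "R = {x. \<forall>H\<in>P. 0 \<le> \<nu> H \<bullet> x}"
  have nb: "\<And>H. H \<in> P \<Longrightarrow> \<nu> H \<bullet> b = 1" using assms normal_base by auto
  then have "R = closed_cell UNIV (\<nu> ` P) b" by (auto simp: R closed_cell_def)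
  then have "R \<in> regions P" using regions_subset_eq[OF assms] nb by auto
  then show "R \<in> regions P \<and> base_region \<subseteq> R" using assms by (auto simp: R base_region_def)
qed

text \<open>A facet has codimension 1, so no other hyperplane contains it and a generic point of it
  is a witness \<open>v\<close>. Conversely, a witness makes \<open>H \<inter> R\<close> a closed
  cell of \<open>H\<close> that affinely spans \<open>H\<close>.\<close>

lemma basic_hyperplanes_eq:
  assumes P: "P \<subseteq> A"
  shows "basic_hyperplanes base_region P = {H. basic P H}"
proof -
  define R where "R = {x. \<forall>H\<in>P. 0 \<le> \<nu> H \<bullet> x}"
  have nb: "\<And>H. H \<in> P \<Longrightarrow> \<nu> H \<bullet> b = 1" using P normal_base by auto
  have fin: "finite P" using P finite_A finite_subset by blast
  have R_cell: "R = closed_cell UNIV (\<nu> ` P) b" using nb by (auto simp: R_def closed_cell_def)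
  have "affine hull R = UNIV"
    unfolding R_cell by (rule affine_hull_closed_cell) (use fin nb in auto)
  then have dim_R: "aff_dim R = int DIM('a)" by (simp add: aff_dim_eq_full)
  have conv_R: "convex R" unfolding R_cell by (simp add: convex_closed_cell)
  have "(H \<inter> R) facet_of R \<longleftrightarrow> (\<exists>v\<in>H. \<forall>K\<in>P - {H}. 0 < \<nu> K \<bullet> v)" if H: "H \<in> P" for H
  proof
    have HA: "H \<in> A" using H P by auto
    note subH = subspace_hyperplane_mem[OF HA]
    {
      assume "(H \<inter> R) facet_of R"
      then have ne: "H \<inter> R \<noteq> {}" and dim_HR: "aff_dim (H \<inter> R) = int DIM('a) - 1"
        using dim_R by (auto simp: facet_of_def)
      have "\<exists>x\<in>H \<inter> R. \<forall>n\<in>\<nu> ` (P - {H}). n \<bullet> x \<noteq> 0"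
      proof (rule convex_avoids_hyperplanes)
        fix n assume "n \<in> \<nu> ` (P - {H})"
        then obtain K where K: "K \<in> A" "K \<noteq> H" "n = \<nu> K" using P by auto
        show "\<exists>x\<in>H \<inter> R. n \<bullet> x \<noteq> 0"
        proof (rule ccontr)
          assume "\<not> (\<exists>x\<in>H \<inter> R. n \<bullet> x \<noteq> 0)"
          then have "H \<inter> R \<subseteq> H \<inter> K" using K mem_iff by auto
          then have "aff_dim (H \<inter> R) \<le> int DIM('a) - 2"
            using aff_dim_subset aff_dim_Int_hyperplanes[OF HA K(1)] K(2) by metis
          then show False using dim_HR by simp
        qed
      next
        show "convex (H \<inter> R)" using conv_R subH by (simp add: convex_Int subspace_imp_convex)
      qed (use fin ne in auto)
      then obtain v where v: "v \<in> H" "v \<in> R" "\<And>K. K \<in> P - {H} \<Longrightarrow> \<nu> K \<bullet> v \<noteq> 0" by auto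
      then have "\<And>K. K \<in> P - {H} \<Longrightarrow> 0 < \<nu> K \<bullet> v" by (force simp: R_def less_le)
      then show "\<exists>v\<in>H. \<forall>K\<in>P - {H}. 0 < \<nu> K \<bullet> v" using v(1) by auto
    next
      assume "\<exists>v\<in>H. \<forall>K\<in>P - {H}. 0 < \<nu> K \<bullet> v"
      then obtain v where v: "v \<in> H" "\<And>K. K \<in> P \<Longrightarrow> K \<noteq> H \<Longrightarrow> 0 < \<nu> K \<bullet> v" by auto
      have "x \<in> H \<inter> R \<longleftrightarrow> x \<in> closed_cell H (\<nu> ` (P - {H})) v" for x
      proof -
        have "0 \<le> (\<nu> K \<bullet> x) * (\<nu> K \<bullet> v) \<longleftrightarrow> 0 \<le> \<nu> K \<bullet> x" if "K \<in> P - {H}" for K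
          using v(2)[of K] that by (simp add: zero_le_mult_iff)
        moreover have "0 \<le> \<nu> H \<bullet> x" if "x \<in> H" using that mem_iff[OF HA] by simp
        ultimately show ?thesis by (auto simp: R_def closed_cell_def)
      qed
      then have HR: "H \<inter> R = closed_cell H (\<nu> ` (P - {H})) v" by blast
      have v_ne: "n \<bullet> v \<noteq> 0" if "n \<in> \<nu> ` (P - {H})" for n
        using that v(2) by (metis DiffE imageE less_irrefl singletonI)
      have "affine hull (H \<inter> R) = H"
        unfolding HR
        by (rule affine_hull_closed_cell[OF subH _ v(1) v_ne]) (use fin in auto)
      then have "aff_dim (H \<inter> R) = aff_dim H" by (metis aff_dim_affine_hull)
      also have "\<dots> = int DIM('a) - 1"
        using dim_hyperplane_mem[OF HA] subH by (simp add: aff_dim_subspace)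
      finally have "aff_dim (H \<inter> R) = aff_dim R - 1" by (simp add: dim_R)
      moreover have "(R \<inter> {x. \<nu> H \<bullet> x = 0}) face_of R"
        by (rule face_of_Int_supporting_hyperplane_ge[OF conv_R]) (use H in \<open>auto simp: R_def\<close>)
      moreover have "R \<inter> {x. \<nu> H \<bullet> x = 0} = H \<inter> R" using mem_iff[OF HA] by auto
      moreover have "H \<inter> R \<noteq> {}"
        unfolding HR using v(1) by (auto simp: closed_cell_def)
      ultimately show "(H \<inter> R) facet_of R" by (simp add: facet_of_def)
    }
  qed
  moreover have "basic_hyperplanes base_region P = {H \<in> P. (H \<inter> R) facet_of R}"
  proof -
    have "(\<exists>Q\<in>regions P. base_region \<subseteq> Q \<and> (H \<inter> Q) facet_of Q) \<longleftrightarrow> (H \<inter> R) facet_of R" for H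
      using region_containing_base[OF P, folded R_def] by metis
    then show ?thesis by (simp add: basic_hyperplanes_def)
  qed
  ultimately show ?thesis by (auto simp: basic_def)
qed

lemma cuts_iff_cut: "cuts A base_region H K \<longleftrightarrow> cut H K"
proof -
  have "pencil H K \<subseteq> A" by (auto simp: pencil_def)
  then show ?thesis
    by (auto simp: cuts_def cut_def rank_two_containing_iff basic_hyperplanes_eq)
qed

section \<open>Shards as closed cells named by uncut points\<close>

abbreviation cutters :: "'a set \<Rightarrow> 'a set" where
  "cutters H \<equiv> \<nu> ` {K. cut K H}"

definition shard :: "'a set \<Rightarrow> 'a \<Rightarrow> 'a set" where
  "shard H w = closed_cell H (cutters H) w"

lemma finite_cutters: "finite (cutters H)"
  using finite_subset[OF _ finite_A, of "{K. cut K H}"] by (auto simp: cut_def)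

lemma shards_in_eq:
  assumes "H \<in> A"
  shows "shards_in A base_region H = {shard H w | w. uncut H w}"
proof -
  have mem: "\<And>K x. cut K H \<Longrightarrow> x \<in> K \<longleftrightarrow> \<nu> K \<bullet> x = 0" using mem_iff by (auto simp: cut_def)
  have "\<Union>{K \<in> A. cuts A base_region K H} = (\<Union>n\<in>cutters H. {x. n \<bullet> x = 0})"
    using mem by (auto simp: cuts_iff_cut cut_def)
  then have "shards_in A base_region H = {closed_cell H (cutters H) w | w. w \<in> H \<and> (\<forall>n\<in>cutters H. n \<bullet> w \<noteq> 0)}"
    unfolding shards_in_def
    using closure_components_eq_closed_cells[OF subspace_hyperplane_mem[OF assms], of "cutters H"]
    by (simp only:)
  also have "\<dots> = {shard H w | w. uncut H w}"
    using mem assms by (auto simp: shard_def uncut_def)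
  finally show ?thesis .
qed

lemma uncut_cell:
  assumes "uncut H w"
  shows "subspace H" "w \<in> H" "\<And>n. n \<in> cutters H \<Longrightarrow> n \<bullet> w \<noteq> 0"
proof -
  have HA: "H \<in> A" and wH: "w \<in> H" and unc: "\<And>K. cut K H \<Longrightarrow> w \<notin> K"
    using assms by (auto simp: uncut_def)
  show "subspace H" "w \<in> H" using HA wH by (auto intro: subspace_hyperplane_mem)
  fix n assume "n \<in> cutters H"
  then obtain K where K: "cut K H" "n = \<nu> K" by auto
  then have "K \<in> A" by (simp add: cut_def)
  then show "n \<bullet> w \<noteq> 0" using unc[OF K(1)] K(2) by (simp add: mem_iff)
qed

lemma rel_interior_shard:
  assumes "uncut H w"
  shows "rel_interior (shard H w) = cell H (cutters H) w"
  unfolding shard_def by (rule rel_interior_closed_cell[OF uncut_cell(1)[OF assms] finite_cutters uncut_cell(2,3)[OF assms]])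

lemma uncut_in_cell:
  assumes "uncut H w" "x \<in> cell H (cutters H) w"
  shows "uncut H x"
proof -
  have "x \<notin> K" if "cut K H" for K
  proof -
    have "K \<in> A" using that by (simp add: cut_def)
    moreover have "0 < (\<nu> K \<bullet> x) * (\<nu> K \<bullet> w)" using assms(2) that by (simp add: cell_def)
    ultimately show ?thesis by (auto simp: mem_iff)
  qed
  then show ?thesis using assms by (auto simp: uncut_def cell_def)
qed

text \<open>A shard affinely spans its hyperplane, which makes the description in
  \<open>shard_hyperplane\<close> unique.\<close>

lemma shard_hyperplane_shard:
  assumes "uncut H w"
  shows "shard_hyperplane A (shard H w) = H"
  unfolding shard_hyperplane_def
proof (rule the_equality)
  have HA: "H \<in> A" using assms by (simp add: uncut_def)
  then show "H \<in> A \<and> shard H w \<subseteq> H" by (auto simp: shard_def closed_cell_def)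
  fix K assume K: "K \<in> A \<and> shard H w \<subseteq> K"
  have "affine hull (shard H w) = H"
    unfolding shard_def by (rule affine_hull_closed_cell[OF uncut_cell(1)[OF assms] finite_cutters uncut_cell(2,3)[OF assms]])
  moreover have "affine hull (shard H w) \<subseteq> K"
    using K by (intro hull_minimal) (auto simp: subspace_imp_affine subspace_hyperplane_mem)
  ultimately show "K = H" using hyperplane_subset_eq[OF HA, of K] K by simp
qed

text \<open>The common relative interior point \<open>x\<close> is an uncut point of
  \<open>H1\<close> lying in \<open>H\<close>, so \<open>H1\<close> is basic in their pencil and
  cuts \<open>H2\<close>. The relative interiors meet in a nonempty open subset of
  \<open>H1 \<inter> H\<close>, which provides codimension 2.\<close>

lemma compatible_shards_cut:
  assumes unc: "uncut H1 w1" "uncut H2 w2" "uncut H w" "H1 \<noteq> H"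
    and x: "x \<in> cell H1 (cutters H1) w1" "x \<in> cell H (cutters H) w"
    and H2: "H2 \<in> pencil H1 H" "\<not> basic (pencil H1 H) H2"
    and sub: "shard H1 w1 \<inter> shard H w \<subseteq> shard H2 w2"
  shows "cut H1 H2 \<and> aff_dim (shard H1 w1 \<inter> shard H2 w2) = int DIM('a) - 2"
proof
  have A: "H1 \<in> A" "H2 \<in> A" "H \<in> A" using unc by (auto simp: uncut_def)
  have "x \<in> H" using x by (simp add: cell_def)
  then have bas: "basic (pencil H1 H) H1"
    using basic_at_uncut_point[OF uncut_in_cell[OF unc(1) x(1)] A(3) unc(4)] by simp
  then have ne: "H1 \<noteq> H2" using H2 by auto
  have P: "pencil H1 H2 = pencil H1 H"
    by (rule pencil_eqI[OF A(1,3) mem_pencil_left[OF A(1)] H2(1) ne])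
  then show "cut H1 H2" using A ne bas H2 by (simp add: cut_def)
  have "H1 \<inter> H2 \<subseteq> H"
    using mem_pencil_right[OF A(3), of H1] P by (auto simp: pencil_def)
  moreover have "H1 \<inter> H \<subseteq> H2" using H2(1) by (auto simp: pencil_def)
  ultimately have UH: "H1 \<inter> H2 = H1 \<inter> H" by auto
  have sU: "subspace (H1 \<inter> H)" using A by (simp add: subspace_inter subspace_hyperplane_mem)
  let ?C = "cell H1 (cutters H1) w1 \<inter> cell H (cutters H) w"
  have "?C = cell (H1 \<inter> H) (cutters H1) w1 \<inter> cell (H1 \<inter> H) (cutters H) w"
    by (auto simp: cell_def)
  then have "openin (top_of_set (H1 \<inter> H)) ?C"
    by (auto intro!: openin_Int openin_cell finite_cutters)
  moreover have "affine hull (H1 \<inter> H) = H1 \<inter> H"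
    using sU by (simp add: affine_hull_eq subspace_imp_affine)
  ultimately have "affine hull ?C = H1 \<inter> H"
    using affine_hull_openin[of "H1 \<inter> H" ?C] x by (metis IntI empty_iff)
  then have "aff_dim ?C = aff_dim (H1 \<inter> H)" by (metis aff_dim_affine_hull)
  also have "\<dots> = int DIM('a) - 2" by (rule aff_dim_Int_hyperplanes[OF A(1,3) unc(4)])
  finally have dC: "aff_dim ?C = int DIM('a) - 2" .
  have "?C \<subseteq> shard H1 w1 \<inter> shard H w"
    by (auto simp: cell_def shard_def closed_cell_def less_imp_le)
  then have "?C \<subseteq> shard H1 w1 \<inter> shard H2 w2" using sub by blast
  then have "int DIM('a) - 2 \<le> aff_dim (shard H1 w1 \<inter> shard H2 w2)"
    using aff_dim_subset dC by metis
  moreover have "shard H1 w1 \<inter> shard H2 w2 \<subseteq> H1 \<inter> H2"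
    by (auto simp: shard_def closed_cell_def)
  then have "aff_dim (shard H1 w1 \<inter> shard H2 w2) \<le> int DIM('a) - 2"
    using aff_dim_subset aff_dim_Int_hyperplanes[OF A(1,2) ne] by metis
  ultimately show "aff_dim (shard H1 w1 \<inter> shard H2 w2) = int DIM('a) - 2" by linarith
qed

end

section \<open>The compatible shard belonging to an arrow, and the equivalence\<close>

context simplicial_based_arrangement
begin

text \<open>Here \<open>H\<close> is the second basic hyperplane of the pencil, and \<open>w\<close>
  is a point of the intersection of the two given shards lying on no hyperplane outside the
  pencil.\<close>

lemma cut_compatible_shard:
  assumes unc: "uncut H1 w1" "uncut H2 w2"
    and cut12: "cut H1 H2"
    and dim12: "aff_dim (shard H1 w1 \<inter> shard H2 w2) = int DIM('a) - 2"
  obtains H w where "uncut H w" "H1 \<noteq> H" "w \<in> cell H1 (cutters H1) w1"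
    "H2 \<in> pencil H1 H" "\<not> basic (pencil H1 H) H2"
    "shard H1 w1 \<inter> shard H w \<subseteq> shard H2 w2"
proof -
  let ?P = "pencil H1 H2" and ?C = "shard H1 w1 \<inter> shard H2 w2"
  have A: "H1 \<in> A" "H2 \<in> A" "H1 \<noteq> H2" and bas: "basic ?P H1" "\<not> basic ?P H2"
    using cut12 by (auto simp: cut_def)
  obtain E F where "extremes ?P E F" using pencil_extremes[OF A] .
  then obtain H where ext: "extremes ?P H1 H"
    using basic_iff_extreme[of ?P E F H1] bas(1) extremes_sym[of ?P E F] by blast
  have HA: "H \<in> A" and H1H: "H1 \<noteq> H" and P: "pencil H1 H = ?P"
    using ext by (auto simp: extremes_def)
  have H_P: "H \<in> ?P" using mem_pencil_right[OF HA, of H1] P by simp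
  have sub_C: "?C \<subseteq> H1 \<inter> H2" by (auto simp: shard_def closed_cell_def)
  have conv: "convex ?C"
    unfolding shard_def using uncut_cell(1)[OF unc(1)] uncut_cell(1)[OF unc(2)]
    by (intro convex_Int convex_closed_cell subspace_imp_convex)
  \<comment> \<open>The intersection \<open>?C\<close> has the full dimension of
    \<open>H1 \<inter> H2\<close>, so a hyperplane containing it belongs to the pencil.\<close>
  have "\<exists>x\<in>?C. \<forall>n\<in>\<nu> ` (A - ?P). n \<bullet> x \<noteq> 0"
  proof (rule convex_avoids_hyperplanes)
    have "0 \<in> ?C" using uncut_cell(1)[OF unc(1)] uncut_cell(1)[OF unc(2)]
      by (auto simp: shard_def closed_cell_def subspace_0)
    then show "?C \<noteq> {}" by auto
    fix n assume "n \<in> \<nu> ` (A - ?P)"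
    then obtain K where K: "K \<in> A" "K \<notin> ?P" "n = \<nu> K" by auto
    show "\<exists>x\<in>?C. n \<bullet> x \<noteq> 0"
    proof (rule ccontr)
      assume "\<not> (\<exists>x\<in>?C. n \<bullet> x \<noteq> 0)"
      then have sub: "?C \<subseteq> H1 \<inter> H2 \<inter> K" using K mem_iff sub_C by auto
      have sp: "subspace (H1 \<inter> H2 \<inter> K)" "subspace (H1 \<inter> H2)"
        using A K by (auto simp: subspace_inter subspace_hyperplane_mem)
      have "aff_dim ?C \<le> int (dim (H1 \<inter> H2 \<inter> K))"
        using aff_dim_subset[OF sub] aff_dim_subspace[OF sp(1)] by simp
      then have "dim (H1 \<inter> H2) \<le> dim (H1 \<inter> H2 \<inter> K)"
        using dim12 dim_Int_hyperplanes[OF A] by linarith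
      then have "H1 \<inter> H2 \<inter> K = H1 \<inter> H2"
        by (intro subspace_dim_equal sp) auto
      then show False using K by (auto simp: pencil_def)
    qed
  qed (use conv finite_A in auto)
  then obtain w where w: "w \<in> ?C" and w_off: "\<And>K. K \<in> A \<Longrightarrow> K \<notin> ?P \<Longrightarrow> \<nu> K \<bullet> w \<noteq> 0"
    by auto
  have wH: "w \<in> H1" "w \<in> H2" "w \<in> H" using w sub_C H_P by (auto simp: pencil_def)
  \<comment> \<open>Within one pencil only nonbasic members are cut. Hence whatever cuts a basic
    member is outside the pencil and misses \<open>w\<close>, which makes \<open>w\<close> uncut
    both in \<open>H\<close> and in \<open>H1\<close>.\<close>
  have off: "K \<notin> ?P" if "cut K L" "L \<in> ?P" "basic ?P L" for K L
  proof
    assume K: "K \<in> ?P"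
    have "pencil K L = ?P"
      by (rule pencil_eqI[OF A(1,2) K that(2)]) (use that in \<open>auto simp: cut_def\<close>)
    then show False using that by (auto simp: cut_def)
  qed
  have bas_H: "basic ?P H" using basic_iff_extreme[OF ext] by simp
  have "w \<notin> K" if "cut K H" for K
    using off[OF that H_P bas_H] w_off[of K] that mem_iff by (auto simp: cut_def)
  then have uncH: "uncut H w" using HA wH by (auto simp: uncut_def)
  have w_cell: "w \<in> cell H1 (cutters H1) w1"
  proof -
    have "0 < (\<nu> K \<bullet> w) * (\<nu> K \<bullet> w1)" if K: "cut K H1" for K
    proof -
      have "\<nu> K \<bullet> w \<noteq> 0"
        using off[OF K mem_pencil_left[OF A(1)] bas(1)] w_off[of K] K by (auto simp: cut_def)
      moreover have "\<nu> K \<bullet> w1 \<noteq> 0" using uncut_cell(3)[OF unc(1)] K by auto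
      moreover have "0 \<le> (\<nu> K \<bullet> w) * (\<nu> K \<bullet> w1)" using w K by (auto simp: shard_def closed_cell_def)
      ultimately show ?thesis by (auto simp: less_le)
    qed
    then show ?thesis using wH by (auto simp: cell_def)
  qed
  have "shard H1 w1 \<inter> shard H w \<subseteq> shard H2 w2"
  proof
    fix x assume x: "x \<in> shard H1 w1 \<inter> shard H w"
    have xH: "x \<in> H1" "x \<in> H" using x by (auto simp: shard_def closed_cell_def)
    have H2_P: "H2 \<in> pencil H1 H" using mem_pencil_right[OF A(2)] P by simp
    then have xH2: "x \<in> H2" using xH by (auto simp: pencil_def)
    have "0 \<le> (\<nu> K \<bullet> x) * (\<nu> K \<bullet> w2)" if K: "cut K H2" for K
    proof (rule ccontr)
      assume neg: "\<not> 0 \<le> (\<nu> K \<bullet> x) * (\<nu> K \<bullet> w2)"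
      have KA: "K \<in> A" using K by (simp add: cut_def)
      have "x \<notin> K" using neg KA by (auto simp: mem_iff)
      then have nP: "K \<notin> ?P" using xH xH2 by (auto simp: pencil_def)
      have "0 \<le> (\<nu> K \<bullet> w) * (\<nu> K \<bullet> w2)" using w K by (auto simp: shard_def closed_cell_def)
      moreover have w_ne: "\<nu> K \<bullet> w \<noteq> 0" by (rule w_off[OF KA nP])
      ultimately have opp: "(\<nu> K \<bullet> w) * (\<nu> K \<bullet> x) < 0"
        using neg by (auto simp: mult_less_0_iff zero_le_mult_iff)
      \<comment> \<open>Opposite signs at \<open>w\<close> and \<open>x\<close> make the combination
        with these weights vanish under \<open>\<nu> K\<close>. Positive weight on \<open>w\<close>
        keeps it in the open cells of both shards.\<close>
      define s where "s = \<bar>\<nu> K \<bullet> x\<bar>"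
      define t where "t = \<bar>\<nu> K \<bullet> w\<bar>"
      define z where "z = s *\<^sub>R w + t *\<^sub>R x"
      have st: "0 < s" "0 \<le> t" using opp by (auto simp: s_def t_def)
      have "\<nu> K \<bullet> z = 0"
        using opp by (auto simp: z_def s_def t_def inner_add_right mult_less_0_iff)
      then have zK: "z \<in> K" using KA by (simp add: mem_iff)
      have "z \<in> cell H1 (cutters H1) w1"
        unfolding z_def using cell_open_segment[OF uncut_cell(1)[OF unc(1)] w_cell _ st] x
        by (auto simp: shard_def)
      then have u1: "uncut H1 z" by (rule uncut_in_cell[OF unc(1)])
      have "w \<in> cell H (cutters H) w" by (rule cell_self[OF uncut_cell(2,3)[OF uncH]])
      then have "z \<in> cell H (cutters H) w"
        unfolding z_def using cell_open_segment[OF uncut_cell(1)[OF uncH] _ _ st] x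
        by (auto simp: shard_def)
      then have u2: "uncut H z" by (rule uncut_in_cell[OF uncH])
      \<comment> \<open>Both \<open>H1\<close> and \<open>H\<close> are uncut at \<open>z\<close>,
        while \<open>K\<close> passes through \<open>z\<close> and cuts \<open>H2\<close>. But
        \<open>K\<close> misses the point \<open>x\<close> of \<open>H1 \<inter> H2\<close>, so it
        cannot belong to the pencil.\<close>
      have "K \<in> pencil H1 H"
        by (rule cutter_in_pencil_of_uncut[OF u1 u2 H1H H2_P K zK])
      then show False using nP P by simp
    qed
    then show "x \<in> shard H2 w2" using xH2 by (auto simp: shard_def closed_cell_def)
  qed
  moreover have "H2 \<in> pencil H1 H" using mem_pencil_right[OF A(2)] P by simp
  ultimately show thesis using that[OF uncH H1H w_cell] bas(2) P by simp
qed

lemma shard_arrow_iff: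
  assumes "S1 \<in> shards A base_region" "S2 \<in> shards A base_region"
  shows "(S1, S2) \<in> shard_digraph A base_region \<longleftrightarrow>
    (\<exists>S1' \<in> shards A base_region.
       compatible S1 S1' \<and>
       (\<exists>A'. rank_two_containing A (shard_hyperplane A S1) (shard_hyperplane A S1') A' \<and>
             shard_hyperplane A S2 \<in> A' \<and>
             shard_hyperplane A S2 \<notin> basic_hyperplanes base_region A') \<and>
       S1 \<inter> S1' \<subseteq> S2)"
proof -
  have shardsE: "\<exists>H w. uncut H w \<and> S = shard H w" if "S \<in> shards A base_region" for S
    using that shards_in_eq by (auto simp: shards_def)
  have shardsI: "shard H w \<in> shards A base_region" if "uncut H w" for H w
    using that shards_in_eq by (auto simp: shards_def uncut_def)
  obtain H1 w1 where S1: "uncut H1 w1" "S1 = shard H1 w1" using shardsE assms by blast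
  obtain H2 w2 where S2: "uncut H2 w2" "S2 = shard H2 w2" using shardsE assms by blast
  have A: "H1 \<in> A" "H2 \<in> A" using S1 S2 by (auto simp: uncut_def)
  have pA: "pencil H K \<subseteq> A" for H K by (auto simp: pencil_def)
  have hyp: "shard_hyperplane A S1 = H1" "shard_hyperplane A S2 = H2"
    using S1 S2 shard_hyperplane_shard by auto
  show ?thesis (is "?L = ?R")
  proof
    assume ?L
    then have "cut H1 H2" "aff_dim (shard H1 w1 \<inter> shard H2 w2) = int DIM('a) - 2"
      using hyp S1 S2 by (auto simp: shard_digraph_def cuts_iff_cut)
    then obtain H w where H: "uncut H w" "H1 \<noteq> H" "w \<in> cell H1 (cutters H1) w1"
      "H2 \<in> pencil H1 H" "\<not> basic (pencil H1 H) H2"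
      "shard H1 w1 \<inter> shard H w \<subseteq> shard H2 w2"
      using cut_compatible_shard[OF S1(1) S2(1)] by blast
    \<comment> \<open>The naming point \<open>w\<close> of the new shard is itself the common point
      of the two relative interiors.\<close>
    have "w \<in> cell H (cutters H) w" by (rule cell_self[OF uncut_cell(2,3)[OF H(1)]])
    then have "compatible S1 (shard H w)"
      using H(3) by (auto simp: compatible_def S1(2) rel_interior_shard[OF S1(1)] rel_interior_shard[OF H(1)])
    moreover have "rank_two_containing A H1 H (pencil H1 H)"
      using A H by (auto simp: rank_two_containing_iff uncut_def)
    ultimately show ?R
      using shardsI[OF H(1)] H hyp S1(2) S2(2) shard_hyperplane_shard[OF H(1)] basic_hyperplanes_eq[OF pA]
      by (intro bexI[of _ "shard H w"]) auto
  next
    assume ?R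
    then obtain S A' where S: "S \<in> shards A base_region" "compatible S1 S"
      "rank_two_containing A H1 (shard_hyperplane A S) A'"
      "H2 \<in> A'" "H2 \<notin> basic_hyperplanes base_region A'" "S1 \<inter> S \<subseteq> S2"
      using hyp by auto
    obtain H w where H: "uncut H w" "S = shard H w" using shardsE S(1) by blast
    have A': "H1 \<noteq> H" "A' = pencil H1 H"
      using S(3) H shard_hyperplane_shard[OF H(1)] by (auto simp: rank_two_containing_iff)
    obtain x where "x \<in> cell H1 (cutters H1) w1" "x \<in> cell H (cutters H) w"
      using S(2) by (auto simp: compatible_def S1(2) H(2) rel_interior_shard[OF S1(1)] rel_interior_shard[OF H(1)])
    moreover have "H2 \<in> pencil H1 H" "\<not> basic (pencil H1 H) H2"
      using S(4,5) A' basic_hyperplanes_eq[OF pA] by auto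
    ultimately have "cut H1 H2 \<and> aff_dim (shard H1 w1 \<inter> shard H2 w2) = int DIM('a) - 2"
      using compatible_shards_cut[OF S1(1) S2(1) H(1) A'(1)] S(6) S1(2) S2(2) H(2) by blast
    then show ?L using assms hyp S1(2) S2(2) by (simp add: shard_digraph_def cuts_iff_cut)
  qed
qed

end

section \<open>Reduction of an arbitrary base region to normalised normals\<close>

theorem theorem2p10:
  fixes A :: "'a::euclidean_space set set" and B S1 S2 :: "'a set"
  assumes "simplicial_arrangement A"
    and "B \<in> regions A"
    and "S1 \<in> shards A B"
    and "S2 \<in> shards A B"
  shows "(S1, S2) \<in> shard_digraph A B \<longleftrightarrow>
    (\<exists>S1' \<in> shards A B.
       compatible S1 S1' \<and>
       (\<exists>A'. rank_two_containing A (shard_hyperplane A S1) (shard_hyperplane A S1') A' \<and>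
             shard_hyperplane A S2 \<in> A' \<and>
             shard_hyperplane A S2 \<notin> basic_hyperplanes B A') \<and>
       S1 \<inter> S1' \<subseteq> S2)"
proof -
  have arr: "finite A" "\<And>H. H \<in> A \<Longrightarrow> linear_hyperplane H"
    and simp_reg: "\<And>R. R \<in> regions A \<Longrightarrow> simplicial_cone R"
    using assms(1) by (auto simp: simplicial_arrangement_def arrangement_def)
  obtain m where m: "\<And>H. H \<in> A \<Longrightarrow> H = {x. m H \<bullet> x = 0}"
    using arr(2) unfolding linear_hyperplane_def by metis
  have "\<Union>A = (\<Union>n\<in>m ` A. {x. n \<bullet> x = 0})" using m by auto
  then have "\<exists>b. (\<forall>H\<in>A. m H \<bullet> b \<noteq> 0) \<and> B = closed_cell UNIV (m ` A) b"
    using assms(2) closure_components_eq_closed_cells[of UNIV "m ` A"]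
    unfolding regions_def by auto
  then obtain b where b: "\<And>H. H \<in> A \<Longrightarrow> m H \<bullet> b \<noteq> 0" "B = closed_cell UNIV (m ` A) b"
    by blast
  \<comment> \<open>Division by the value at \<open>b\<close>, which may be negative, orients each
    normal towards the base region as well as scaling it.\<close>
  define \<nu> where "\<nu> H = (1 / (m H \<bullet> b)) *\<^sub>R m H" for H
  interpret based_arrangement A b \<nu>
  proof
    show "H \<in> A \<Longrightarrow> x \<in> H \<longleftrightarrow> \<nu> H \<bullet> x = 0" for H x
      using m b(1) by (auto simp: \<nu>_def)
  qed (use arr(1) b(1) in \<open>auto simp: \<nu>_def\<close>)
  interpret simplicial_based_arrangement A b \<nu>
  proof
    fix y assume "generic y"
    then have "closed_cell UNIV (\<nu> ` A) y \<in> regions A"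
      using regions_subset_eq[of A] by (auto simp: generic_def)
    then show "simplicial_cone (closed_cell UNIV (\<nu> ` A) y)" by (rule simp_reg)
  qed
  have "0 \<le> (m H \<bullet> x) * (m H \<bullet> b) \<longleftrightarrow> 0 \<le> \<nu> H \<bullet> x" if "H \<in> A" for H x
    using b(1)[OF that] by (simp add: \<nu>_def zero_le_mult_iff zero_le_divide_iff)
  then have "B = base_region" by (auto simp: b(2) closed_cell_def base_region_def)
  then show ?thesis using shard_arrow_iff[of S1 S2] assms(3,4) by simp
qed

end
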